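(* Let $q=O(k^4)$ be a prime power. There exists a polynomial time algorithm that outputs $\boldsymbol\alpha=(\alpha_1,\ldots,\alpha_{2k})\in\mathbb{F}_q^{2k}$ for which the respective code $\mathrm{RS}_{2k,k}(\boldsymbol\alpha)$ over $\mathbb{F}_q$ can correct a single insdel error.
   Context: $\mathbb{F}_q$ is the finite field with $q$ elements. For distinct elements $\alpha_1,\ldots,\alpha_n\in\mathbb{F}_q$ and $k<n$, the Reed--Solomon code of dimension $k$ and length $n$ with evaluation vector $\boldsymbol\alpha=(\alpha_1,\ldots,\alpha_n)$ is $\mathrm{RS}_{n,k}(\boldsymbol\alpha)=\{(f(\alpha_1),\ldots,f(\alpha_n)) : f\in\mathbb{F}_q[x],\ \deg f<k\}\subseteq\mathbb{F}_q^n$. "Polynomial time" means polynomial in $k$. The hypothesis $q=O(k^4)$ specifies the order of magnitude of the given field size: $q$ is a prime power of order $k^4$, with the implied constant sufficiently large (the algorithm is run over $\mathbb{F}_q$ for a prime power $q\ge 100k^4$ of this order). An insdel error is an insertion of a symbol or a deletion of a symbol. A code $\mathcal{C}\subseteq\mathbb{F}_q^n$ can correct a single insdel error if and only if $\mathrm{LCS}(\mathbf{c},\mathbf{c}')\le n-2$ for all distinct $\mathbf{c},\mathbf{c}'\in\mathcal{C}$, where $\mathrm{LCS}$ denotes the length of a longest common (not necessarily contiguous) subsequence. *)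

theory Defs
  imports
    "HOL-Algebra.Polynomials"
    "HOL-Number_Theory.Prime_Powers"
    "HOL-Library.Sublist"
begin

section \<open>Insertions and deletions\<close>

definition insdel_errors :: "'a set \<Rightarrow> 'a list \<Rightarrow> 'a list set" where
  "insdel_errors A w =
     {us @ a # vs | us a vs. a \<in> A \<and> w = us @ vs} \<union> {us @ vs | us a vs. w = us @ a # vs}"

text \<open>A code corrects a single insdel error if the transmitted codeword is determined by the
  received word whenever at most one insdel error occurred.\<close>

definition corrects_single_insdel :: "'a set \<Rightarrow> 'a list set \<Rightarrow> bool" where
  "corrects_single_insdel A C \<longleftrightarrow>
     (\<forall>c\<in>C. \<forall>c'\<in>C. c \<noteq> c' \<longrightarrow>
        insert c (insdel_errors A c) \<inter> insert c' (insdel_errors A c') = {})"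

definition lcs :: "'a list \<Rightarrow> 'a list \<Rightarrow> nat" where
  "lcs xs ys = Max (length ` {zs. subseq zs xs \<and> subseq zs ys})"

lemma finite_common_subseqs: "finite {zs. subseq zs xs \<and> subseq zs ys}"
  by (rule finite_subset[of _ "set (subseqs xs)"]) auto

lemma lcs_ge_iff:
  "m \<le> lcs xs ys \<longleftrightarrow> (\<exists>zs. subseq zs xs \<and> subseq zs ys \<and> m \<le> length zs)"
proof -
  have "length ` {zs. subseq zs xs \<and> subseq zs ys} \<noteq> {}"
    by (auto intro: exI[of _ "[]"])
  then show ?thesis
    unfolding lcs_def by (subst Max_ge_iff) (auto simp: finite_common_subseqs)
qed

lemma subseq_delete_one: "subseq (us @ vs) (us @ a # vs)"
  by (simp add: subseq_append' subseq_order.order_refl list_emb_Cons)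

lemma subseq_length_Suc_imp_delete:
  assumes "subseq zs xs" and "length xs = Suc (length zs)"
  shows "\<exists>us a vs. xs = us @ a # vs \<and> zs = us @ vs"
  using assms
proof (induction rule: list_emb.induct)
  case (list_emb_Cons xs ys y)
  then have "xs = ys" by (intro subseq_same_length) simp_all
  then have "y # ys = [] @ y # ys \<and> xs = [] @ ys" by simp
  then show ?case by blast
next
  case (list_emb_Cons2 x y xs ys)
  then obtain us a vs where "ys = us @ a # vs" "xs = us @ vs" by auto
  then have "y # ys = (y # us) @ a # vs \<and> x # xs = (y # us) @ vs"
    using list_emb_Cons2 by simp
  then show ?case by blast
qed (auto simp: length_Suc_conv)

lemma subseq_shorten:
  "subseq zs xs \<Longrightarrow> m \<le> length zs \<Longrightarrow> subseq (take m zs) xs"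
  by (meson prefix_imp_subseq subseq_order.order_trans take_is_prefix)

lemma common_supersequence_imp_common_subsequence:
  assumes "us @ a # vs = us' @ a' # vs'" and "us @ vs \<noteq> us' @ vs'"
  shows "\<exists>zs. subseq zs (us @ vs) \<and> subseq zs (us' @ vs') \<and> length (us @ vs) \<le> Suc (length zs)"
proof -
  have main: "\<exists>zs. subseq zs (us @ vs) \<and> subseq zs (us' @ vs') \<and>
      length (us @ vs) \<le> Suc (length zs)"
    if eq: "us @ a # vs = us' @ a' # vs'" and ne: "us @ vs \<noteq> us' @ vs'"
      and le: "length us \<le> length us'" for us a vs us' a' and vs' :: "'a list"
  proof -
    from eq le obtain ws where ws: "us' = us @ ws" "a # vs = ws @ a' # vs'"
      unfolding append_eq_append_conv2 by fastforce
    show ?thesis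
    proof (cases ws)
      case Nil
      with ws ne show ?thesis by simp
    next
      case (Cons b ws')
      with ws have [simp]: "vs = ws' @ a' # vs'" "us' = us @ a # ws'" by auto
      have "subseq (us @ ws' @ vs') (us @ vs)"
        using subseq_delete_one[of "us @ ws'" vs' a'] by simp
      moreover have "subseq (us @ ws' @ vs') (us' @ vs')"
        using subseq_delete_one[of us "ws' @ vs'" a] by simp
      moreover have "length (us @ vs) \<le> Suc (length (us @ ws' @ vs'))" by simp
      ultimately show ?thesis by blast
    qed
  qed
  have len: "length (us @ vs) = length (us' @ vs')"
    using arg_cong[OF assms(1), of length] by simp
  show ?thesis
  proof (cases "length us \<le> length us'")
    case True
    with main assms show ?thesis by blast
  next
    case False
    then show ?thesis using main[OF assms(1)[symmetric]] assms(2) len by fastforce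
  qed
qed

lemma corrects_single_insdel_iff_lcs:
  assumes len: "\<And>c. c \<in> C \<Longrightarrow> length c = n"
  shows "corrects_single_insdel A C \<longleftrightarrow> (\<forall>c\<in>C. \<forall>c'\<in>C. c \<noteq> c' \<longrightarrow> lcs c c' + 2 \<le> n)"
proof -
  have meet: "insert c (insdel_errors A c) \<inter> insert c' (insdel_errors A c') \<noteq> {} \<longleftrightarrow>
      n \<le> lcs c c' + 1"
    if c: "c \<in> C" "c' \<in> C" "c \<noteq> c'" for c c'
  proof
    assume "n \<le> lcs c c' + 1"
    then have "n - 1 \<le> lcs c c'" by simp
    then obtain zs0 where zs0: "subseq zs0 c" "subseq zs0 c'" "n - 1 \<le> length zs0"
      by (auto simp: lcs_ge_iff)
    define zs where "zs = take (n - 1) zs0"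
    have zs: "subseq zs c" "subseq zs c'" "length zs = n - 1"
      using zs0 by (simp_all add: zs_def subseq_shorten)
    have "n > 0" using c len[of c] len[of c'] by (cases n) auto
    with zs len c have "length c = Suc (length zs)" "length c' = Suc (length zs)" by auto
    then have "zs \<in> insdel_errors A c" "zs \<in> insdel_errors A c'"
      using subseq_length_Suc_imp_delete[OF zs(1)] subseq_length_Suc_imp_delete[OF zs(2)]
      unfolding insdel_errors_def by blast+
    then show "insert c (insdel_errors A c) \<inter> insert c' (insdel_errors A c') \<noteq> {}" by blast
  next
    assume "insert c (insdel_errors A c) \<inter> insert c' (insdel_errors A c') \<noteq> {}"
    then obtain y where y: "y \<in> insert c (insdel_errors A c)" "y \<in> insert c' (insdel_errors A c')"
      by blast
    have L: "length c = n" "length c' = n" using len c by auto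
    note y = y[unfolded insdel_errors_def]
    have "\<exists>zs. subseq zs c \<and> subseq zs c' \<and> n \<le> Suc (length zs)"
    proof -
      consider "length y = n" | "length y = Suc n" | "n = Suc (length y)"
        using y(1) L(1) by auto
      then show ?thesis
      proof cases
        case 1
        have "c = y" using y(1) L(1) 1 by auto
        moreover have "c' = y" using y(2) L(2) 1 by auto
        ultimately show ?thesis using c(3) by simp
      next
        case 2
        obtain us a vs where 1: "y = us @ a # vs" "c = us @ vs" using y(1) L(1) 2 by auto
        obtain us' a' vs' where 2: "y = us' @ a' # vs'" "c' = us' @ vs'" using y(2) L(2) 2 by auto
        have "us @ a # vs = us' @ a' # vs'" using 1(1) 2(1) by (rule subst)
        moreover have "us @ vs \<noteq> us' @ vs'" using c(3) unfolding 1(2) 2(2) .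
        ultimately show ?thesis
          using common_supersequence_imp_common_subsequence L(1) unfolding 1(2) 2(2) by metis
      next
        case 3
        obtain us a vs where 1: "c = us @ a # vs" "y = us @ vs" using y(1) L(1) 3 by auto
        obtain us' a' vs' where 2: "c' = us' @ a' # vs'" "y = us' @ vs'" using y(2) L(2) 3 by auto
        have "subseq y c" unfolding 1 by (rule subseq_delete_one)
        moreover have "subseq y c'" unfolding 2 by (rule subseq_delete_one)
        ultimately show ?thesis using 3 by (metis order_refl)
      qed
    qed
    then obtain zs where "subseq zs c" "subseq zs c'" "n \<le> Suc (length zs)" by blast
    then have "n - 1 \<le> length zs" by simp
    with \<open>subseq zs c\<close> \<open>subseq zs c'\<close> have "n - 1 \<le> lcs c c'" unfolding lcs_ge_iff by blast
    then show "n \<le> lcs c c' + 1" by simp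
  qed
  have "insert c (insdel_errors A c) \<inter> insert c' (insdel_errors A c') = {} \<longleftrightarrow>
      lcs c c' + 2 \<le> n"
    if "c \<in> C" "c' \<in> C" "c \<noteq> c'" for c c'
  proof -
    have "P = {} \<longleftrightarrow> m + 2 \<le> n" if "P \<noteq> {} \<longleftrightarrow> n \<le> m + 1" for P :: "'a list set" and m
      using that by (cases "P = {}") simp_all
    from this[OF meet[OF that]] show ?thesis .
  qed
  then show ?thesis
    unfolding corrects_single_insdel_def by (intro ball_cong refl imp_cong)
qed


section \<open>Reed--Solomon codes\<close>

text \<open>In \<open>HOL-Algebra.Polynomials\<close> a polynomial is its coefficient list, leading coefficient
  first, and \<open>[]\<close> is the zero polynomial; its degree is \<open>-\<infinity>\<close> here, hence the disjunction.\<close>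

definition rs_code :: "('a, 'm) ring_scheme \<Rightarrow> nat \<Rightarrow> 'a list \<Rightarrow> 'a list set" where
  "rs_code F k \<alpha> =
     {map (ring.eval F f) \<alpha> | f. polynomial\<^bsub>F\<^esub> (carrier F) f \<and> (f = [] \<or> degree f < k)}"


section \<open>Algorithms over a finite field\<close>

text \<open>
  Algorithms are programs of a deterministic while language with random access memory: variables
  and arrays hold natural numbers and are named by natural numbers, so that a program is a finite
  object independent of the input. A field with \<open>q\<close> elements is presented to a program as a field
  structure with carrier \<open>{..<q}\<close>, that is, a field element is stored as its index in an
  enumeration of the field, and the field operations are primitive.

  The cost of a run is the number of expression nodes evaluated plus the number of commands
  executed. On natural numbers there is no primitive multiplication, only addition and truncated
  subtraction: the numbers occurring in \<open>t\<close> steps have \<open>O(t)\<close> more bits than the input, so that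
  unit cost is polynomially related to the cost on a Turing machine, given the field operations.
\<close>

datatype aexp =
    Const nat
  | Var nat
  | Arr nat aexp
  | Plus aexp aexp
  | Minus aexp aexp
  | FZero
  | FOne
  | FAdd aexp aexp
  | FNeg aexp
  | FMul aexp aexp
  | FInv aexp

datatype bexp =
    Less aexp aexp
  | Equal aexp aexp
  | Neg bexp
  | Conj bexp bexp

datatype com =
    Skip
  | Assign nat aexp
  | AssignArr nat aexp aexp
  | Seq com com
  | Cond bexp com com
  | While bexp com

type_synonym store = "(nat \<Rightarrow> nat) \<times> (nat \<Rightarrow> nat \<Rightarrow> nat)"

text \<open>Field operations return the number \<open>0\<close> if they are applied outside their domain.\<close>

primrec aval :: "nat ring \<Rightarrow> store \<Rightarrow> aexp \<Rightarrow> nat" where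
  "aval F s (Const n) = n"
| "aval F s (Var x) = fst s x"
| "aval F s (Arr a e) = snd s a (aval F s e)"
| "aval F s (Plus e1 e2) = aval F s e1 + aval F s e2"
| "aval F s (Minus e1 e2) = aval F s e1 - aval F s e2"
| "aval F s FZero = \<zero>\<^bsub>F\<^esub>"
| "aval F s FOne = \<one>\<^bsub>F\<^esub>"
| "aval F s (FAdd e1 e2) =
     (if aval F s e1 \<in> carrier F \<and> aval F s e2 \<in> carrier F
      then aval F s e1 \<oplus>\<^bsub>F\<^esub> aval F s e2 else 0)"
| "aval F s (FNeg e) = (if aval F s e \<in> carrier F then \<ominus>\<^bsub>F\<^esub> aval F s e else 0)"
| "aval F s (FMul e1 e2) =
     (if aval F s e1 \<in> carrier F \<and> aval F s e2 \<in> carrier F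
      then aval F s e1 \<otimes>\<^bsub>F\<^esub> aval F s e2 else 0)"
| "aval F s (FInv e) =
     (if aval F s e \<in> carrier F - {\<zero>\<^bsub>F\<^esub>} then inv\<^bsub>F\<^esub> aval F s e else 0)"

primrec bval :: "nat ring \<Rightarrow> store \<Rightarrow> bexp \<Rightarrow> bool" where
  "bval F s (Less e1 e2) \<longleftrightarrow> aval F s e1 < aval F s e2"
| "bval F s (Equal e1 e2) \<longleftrightarrow> aval F s e1 = aval F s e2"
| "bval F s (Neg b) \<longleftrightarrow> \<not> bval F s b"
| "bval F s (Conj b1 b2) \<longleftrightarrow> bval F s b1 \<and> bval F s b2"

primrec acost :: "aexp \<Rightarrow> nat" where
  "acost (Const n) = 1"
| "acost (Var x) = 1"
| "acost (Arr a e) = 1 + acost e"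
| "acost (Plus e1 e2) = 1 + acost e1 + acost e2"
| "acost (Minus e1 e2) = 1 + acost e1 + acost e2"
| "acost FZero = 1"
| "acost FOne = 1"
| "acost (FAdd e1 e2) = 1 + acost e1 + acost e2"
| "acost (FNeg e) = 1 + acost e"
| "acost (FMul e1 e2) = 1 + acost e1 + acost e2"
| "acost (FInv e) = 1 + acost e"

primrec bcost :: "bexp \<Rightarrow> nat" where
  "bcost (Less e1 e2) = 1 + acost e1 + acost e2"
| "bcost (Equal e1 e2) = 1 + acost e1 + acost e2"
| "bcost (Neg b) = 1 + bcost b"
| "bcost (Conj b1 b2) = 1 + bcost b1 + bcost b2"

text \<open>\<open>exec F c s t s'\<close>: started in \<open>s\<close>, the program \<open>c\<close> halts in \<open>s'\<close> at cost \<open>t\<close>.\<close>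

inductive exec :: "nat ring \<Rightarrow> com \<Rightarrow> store \<Rightarrow> nat \<Rightarrow> store \<Rightarrow> bool" for F where
  Skip: "exec F Skip s 1 s"
| Assign: "exec F (Assign x e) s (1 + acost e) ((fst s)(x := aval F s e), snd s)"
| AssignArr: "exec F (AssignArr a i e) s (1 + acost i + acost e)
    (fst s, (snd s)(a := (snd s a)(aval F s i := aval F s e)))"
| Seq: "exec F c1 s t1 s' \<Longrightarrow> exec F c2 s' t2 s'' \<Longrightarrow> exec F (Seq c1 c2) s (1 + t1 + t2) s''"
| CondTrue: "bval F s b \<Longrightarrow> exec F c1 s t s' \<Longrightarrow> exec F (Cond b c1 c2) s (1 + bcost b + t) s'"
| CondFalse: "\<not> bval F s b \<Longrightarrow> exec F c2 s t s' \<Longrightarrow> exec F (Cond b c1 c2) s (1 + bcost b + t) s'"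
| WhileFalse: "\<not> bval F s b \<Longrightarrow> exec F (While b c) s (1 + bcost b) s"
| WhileTrue: "bval F s b \<Longrightarrow> exec F c s t1 s' \<Longrightarrow> exec F (While b c) s' t2 s'' \<Longrightarrow>
    exec F (While b c) s (1 + bcost b + t1 + t2) s''"

inductive_cases exec_SkipE: "exec F Skip s t s'"
inductive_cases exec_AssignE: "exec F (Assign x e) s t s'"
inductive_cases exec_AssignArrE: "exec F (AssignArr a i e) s t s'"
inductive_cases exec_SeqE: "exec F (Seq c1 c2) s t s'"
inductive_cases exec_CondE: "exec F (Cond b c1 c2) s t s'"
inductive_cases exec_WhileE: "exec F (While b c) s t s'"

lemma exec_deterministic:
  "exec F c s t s' \<Longrightarrow> exec F c s u s'' \<Longrightarrow> u = t \<and> s'' = s'"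
proof (induction arbitrary: u s'' rule: exec.induct)
  case (Skip s)
  then show ?case by (elim exec_SkipE) simp
next
  case (Assign x e s)
  then show ?case by (elim exec_AssignE) simp
next
  case (AssignArr a i e s)
  then show ?case by (elim exec_AssignArrE) simp
next
  case (Seq c1 s t1 s' c2 t2 s2)
  from Seq.prems obtain v1 r v2 where
    r: "u = Suc (v1 + v2)" "exec F c1 s v1 r" "exec F c2 r v2 s''"
    by (rule exec_SeqE)
  from Seq.IH(1)[OF r(2)] have 1: "v1 = t1" "r = s'" by simp_all
  from Seq.IH(2)[OF r(3)[unfolded 1]] show ?case by (simp add: r(1) 1)
next
  case (CondTrue s b c1 t s' c2)
  from CondTrue.prems CondTrue.hyps(1) obtain v where
    v: "u = Suc (bcost b + v)" "exec F c1 s v s''"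
    by (elim exec_CondE) simp_all
  from CondTrue.IH[OF v(2)] show ?case by (simp add: v(1))
next
  case (CondFalse s b c2 t s' c1)
  from CondFalse.prems CondFalse.hyps(1) obtain v where
    v: "u = Suc (bcost b + v)" "exec F c2 s v s''"
    by (elim exec_CondE) simp_all
  from CondFalse.IH[OF v(2)] show ?case by (simp add: v(1))
next
  case (WhileFalse s b c)
  from WhileFalse.prems show ?case
    by (rule exec_WhileE) (use WhileFalse.hyps in simp_all)
next
  case (WhileTrue s b c t1 s' t2 s2)
  from WhileTrue.prems obtain v1 r v2 where
    r: "u = Suc (bcost b + v1 + v2)" "exec F c s v1 r" "exec F (While b c) r v2 s''"
    by (rule exec_WhileE) (use WhileTrue.hyps(1) in simp_all)
  from WhileTrue.IH(1)[OF r(2)] have 1: "v1 = t1" "r = s'" by simp_all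
  from WhileTrue.IH(2)[OF r(3)[unfolded 1]] show ?case by (simp add: r(1) 1)
qed

text \<open>The inputs \<open>k\<close> and \<open>q\<close> are passed in variables \<open>0\<close> and \<open>1\<close>; a vector is returned in the
  initial segment of array \<open>0\<close>.\<close>

definition input_store :: "nat \<Rightarrow> nat \<Rightarrow> store" where
  "input_store k q = ((\<lambda>_. 0)(0 := k, 1 := q), \<lambda>_ _. 0)"

definition output_vector :: "nat \<Rightarrow> store \<Rightarrow> nat list" where
  "output_vector n s = map (snd s 0) [0..<n]"

end

theory Submission
  imports Defs "HOL-Algebra.Polynomial_Divisibility"
begin

text \<open>
  Two distinct codewords of \<open>f\<close> and \<open>g\<close> with a common subsequence of length \<open>2 k - 1\<close> lose one
  position each, say \<open>i < j\<close>. If \<open>j - i < k\<close>, the words agree in \<open>k\<close> positions. Otherwise, after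
  subtracting a constant, \<open>(f, g)\<close> is a nontrivial solution of a square homogeneous system of size
  \<open>2 k\<close> whose row \<open>t\<close> involves no evaluation point after \<open>\<alpha>\<^sub>t\<close>. The points are therefore chosen
  greedily so that all leading principal minors of all these systems are nonzero: given the earlier
  points, each system excludes fewer than \<open>k\<close> values of the next one, because its next pivot is a
  nonzero polynomial of degree less than \<open>k\<close> in it. There are \<open>O(k\<^sup>2)\<close> systems, so some field
  element is left, and an exhaustive search with Gaussian elimination finds it in polynomial time.
\<close>


section \<open>The linear systems of the pairs of deleted positions\<close>

text \<open>Pairs with \<open>j - i + 1 < k\<close> are out of reach of minors: a nonzero polynomial
  of degree less than \<open>k\<close> vanishing at \<open>\<alpha> i\<close>, ...,
  \<open>\<alpha> j\<close>, taken for both f and g, solves the whole system, so its determinant is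
  zero for every choice of points. This is why close pairs are settled by plain interpolation and
  only \<open>i + k \<le> j\<close> enters the construction. The full determinant alone couples all
  the points. Asking for every leading principal minor splits this into conditions on one new point
  each, which a greedy choice can meet; the price is that each next pivot must be shown not to
  vanish identically. The search may visit all q field elements for each point. It is polynomial in
  k because q is at most \<open>C * k ^ 4\<close>, while q is still large enough to exceed the
  \<open>2 * k + 2 * k ^ 3\<close> elements that can be excluded.\<close>

context field
begin

text \<open>Coefficients are indexed by exponent and given by total functions, so that f and g fit
  into one vector by an index shift. \<open>rev\<close> adapts this to \<open>eval\<close>, which
  reads the leading coefficient first.\<close>

definition ev :: "(nat \<Rightarrow> 'a) \<Rightarrow> nat \<Rightarrow> 'a \<Rightarrow> 'a" where
  "ev v n = eval (map v (rev [0..<n]))"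

lemma ev_0 [simp]: "ev v 0 x = \<zero>"
  by (simp add: ev_def)

lemma ev_Suc [simp]: "ev v (Suc n) x = v n \<otimes> x [^] n \<oplus> ev v n x"
  by (simp add: ev_def)

lemma ev_closed [simp]:
  "(\<And>u. v u \<in> carrier R) \<Longrightarrow> x \<in> carrier R \<Longrightarrow> ev v n x \<in> carrier R"
  by (induction n) auto

lemma ev_cong: "(\<And>u. u < n \<Longrightarrow> v u = w u) \<Longrightarrow> ev v n x = ev w n x"
  by (induction n) auto

lemma ev_zero [simp]: "(\<And>u. u < n \<Longrightarrow> v u = \<zero>) \<Longrightarrow> x \<in> carrier R \<Longrightarrow> ev v n x = \<zero>"
  by (induction n) auto

lemma ev_add_smult:
  assumes "\<And>u. v u \<in> carrier R" "\<And>u. w u \<in> carrier R" "c \<in> carrier R" "x \<in> carrier R"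
  shows "ev (\<lambda>u. v u \<oplus> c \<otimes> w u) n x = ev v n x \<oplus> c \<otimes> ev w n x"
proof (induction n)
  case (Suc n)
  have "v n \<in> carrier R" "w n \<in> carrier R" "x [^] n \<in> carrier R"
    "ev v n x \<in> carrier R" "ev w n x \<in> carrier R"
    using assms by simp_all
  then show ?case unfolding ev_Suc Suc using assms(3) by algebra
qed (use assms in simp)

lemma ev_subtract_const:
  assumes "\<And>u. v u \<in> carrier R" "c \<in> carrier R" "x \<in> carrier R" "0 < n"
  shows "ev (v(0 := v 0 \<ominus> c)) n x = ev v n x \<ominus> c"
proof -
  have "ev (v(0 := v 0 \<ominus> c)) (Suc m) x = ev v (Suc m) x \<ominus> c" for m
  proof (induction m)
    case 0
    have "v 0 \<in> carrier R" using assms by simp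
    then show ?case using assms(2,3) by (simp add: a_minus_def)
  next
    case (Suc m)
    have "(v(0 := v 0 \<ominus> c)) (Suc m) = v (Suc m)" by simp
    then have "ev (v(0 := v 0 \<ominus> c)) (Suc (Suc m)) x = v (Suc m) \<otimes> x [^] Suc m \<oplus> (ev v (Suc m) x \<ominus> c)"
      using Suc by (metis ev_Suc)
    also have "\<dots> = v (Suc m) \<otimes> x [^] Suc m \<oplus> ev v (Suc m) x \<ominus> c"
      using assms(1-3) unfolding a_minus_def by (intro a_assoc[symmetric]) (auto simp del: ev_Suc)
    also have "\<dots> = ev v (Suc (Suc m)) x \<ominus> c" by simp
    finally show ?case .
  qed
  with assms(4) show ?thesis by (cases n) auto
qed

lemma minus_eq_zero_iff:
  assumes "a \<in> carrier R" "b \<in> carrier R"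
  shows "a \<ominus> b = \<zero> \<longleftrightarrow> a = b"
  using assms by (metis a_minus_def r_neg minus_equality minus_minus a_inv_closed)

text \<open>A nonzero coefficient below \<open>n\<close> would survive \<open>normalize\<close> and
  leave a nonzero polynomial of degree less than \<open>n\<close> with at least \<open>n\<close>
  roots.\<close>

lemma ev_roots:
  assumes v: "\<And>u. v u \<in> carrier R" and S: "S \<subseteq> carrier R" "finite S" "n \<le> card S"
    and zero: "\<And>x. x \<in> S \<Longrightarrow> ev v n x = \<zero>" and u: "u < n"
  shows "v u = \<zero>"
proof (rule ccontr)
  assume ne: "v u \<noteq> \<zero>"
  define l where "l = map v (rev [0..<n])"
  define p where "p = normalize l"
  have l: "set l \<subseteq> carrier R" using v by (auto simp: l_def)
  have p: "p \<in> carrier (poly_ring R)"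
    using normalize_gives_polynomial[OF l] by (simp add: p_def univ_poly_def)
  have coeff: "coeff l m = (if m < n then v m else \<zero>)" for m
    unfolding l_def by (induction n) auto
  have "p \<noteq> []"
  proof
    assume "p = []"
    then have "coeff l u = \<zero>" unfolding normalize_coeff[of l] p_def by simp
    then show False using coeff ne u by simp
  qed
  have "S \<subseteq> set_mset (roots p)"
  proof
    fix x assume x: "x \<in> S"
    then have "eval p x = \<zero>"
      using zero[OF x] eval_normalize[OF l] S unfolding p_def ev_def l_def by auto
    then show "x \<in> set_mset (roots p)"
      using x S \<open>p \<noteq> []\<close> by (auto simp: roots_mem_iff_is_root[OF p] is_root_def)
  qed
  then have "card S \<le> card (set_mset (roots p))" by (intro card_mono) simp_all
  also have "\<dots> \<le> (\<Sum>x\<in>set_mset (roots p). count (roots p) x)"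
    unfolding card_eq_sum by (intro sum_mono) (simp add: Suc_le_eq)
  also have "\<dots> = size (roots p)" by (simp add: size_multiset_overloaded_eq)
  also have "\<dots> \<le> degree p" by (rule size_roots_le_degree[OF p])
  also have "\<dots> < n"
    using normalize_length_le[of l] u by (simp add: p_def l_def)
  finally show False using S by simp
qed

text \<open>Coefficient lists of polynomials vary in length; padding with zeros brings all of them
  to the vector format of fixed length \<open>n\<close>.\<close>

lemma polynomial_eval_ev:
  assumes "polynomial (carrier R) f" "f = [] \<or> degree f < n"
  shows "\<exists>v. (\<forall>u. v u \<in> carrier R) \<and> (\<forall>x\<in>carrier R. eval f x = ev v n x)"
proof -
  have f: "set f \<subseteq> carrier R" using assms(1) by (rule polynomial_incl)
  have "ev (coeff f) (length f + m) x = eval f x" if "x \<in> carrier R" for m x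
  proof (induction m)
    case 0
    then show ?case by (simp add: ev_def coeff_list)
  next
    case (Suc m)
    have "coeff f (length f + m) = \<zero>" by (simp add: coeff_length)
    then show ?case using Suc f that by (simp add: eval_in_carrier)
  qed
  note * = this[of _ "n - length f"]
  have "length f \<le> n" using assms(2) by (cases f) auto
  then have "length f + (n - length f) = n" by simp
  with * have "ev (coeff f) n x = eval f x" if "x \<in> carrier R" for x
    using that by (simp only:)
  then show ?thesis using f by (intro exI[of _ "coeff f"]) simp
qed

text \<open>The vector \<open>v\<close> holds the coefficients of \<open>f\<close> at \<open>0, \<dots>, k - 1\<close> and those of \<open>g\<close> at
  \<open>k, \<dots>, 2 k - 1\<close>. The rows vanish iff the words of \<open>f\<close> and \<open>g\<close> agree after deleting position
  \<open>i\<close> of the former and \<open>j\<close> of the latter, normalised by \<open>f (\<alpha> i) = 0\<close>, which removes the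
  trivial solutions where \<open>f\<close> and \<open>g\<close> are the same constant.\<close>

definition row :: "nat \<Rightarrow> (nat \<Rightarrow> 'a) \<Rightarrow> nat \<Rightarrow> nat \<Rightarrow> nat \<Rightarrow> (nat \<Rightarrow> 'a) \<Rightarrow> 'a" where
  "row k \<alpha> i j t v =
     ev v k (\<alpha> t) \<ominus>
     (if t = i then \<zero> else ev (\<lambda>u. v (k + u)) k (\<alpha> (if i < t \<and> t \<le> j then t - 1 else t)))"

lemma row_closed [simp]:
  "(\<And>u. v u \<in> carrier R) \<Longrightarrow> (\<And>t. \<alpha> t \<in> carrier R) \<Longrightarrow> row k \<alpha> i j t v \<in> carrier R"
  by (simp add: row_def)

lemma row_cong:
  "(\<And>u. u < 2 * k \<Longrightarrow> v u = w u) \<Longrightarrow> row k \<alpha> i j t v = row k \<alpha> i j t w"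
  unfolding row_def using ev_cong[of k v w] ev_cong[of k "\<lambda>u. v (k + u)" "\<lambda>u. w (k + u)"] by simp

text \<open>The word of f loses the earlier position, so the shift leads from \<open>t\<close> back
  to \<open>t - 1\<close> and never forward. The greedy order of choice rests on this.\<close>

lemma row_cong_points:
  "(\<And>u. u \<le> t \<Longrightarrow> \<alpha> u = \<beta> u) \<Longrightarrow> row k \<alpha> i j t v = row k \<beta> i j t v"
  unfolding row_def by simp

lemma row_zero:
  "(\<And>u. u < 2 * k \<Longrightarrow> v u = \<zero>) \<Longrightarrow> (\<And>t. \<alpha> t \<in> carrier R) \<Longrightarrow> row k \<alpha> i j t v = \<zero>"
  unfolding row_def using ev_zero[of k v] ev_zero[of k "\<lambda>u. v (k + u)"] by (simp add: a_minus_def)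

lemma row_add_smult:
  assumes "\<And>u. v u \<in> carrier R" "\<And>u. w u \<in> carrier R" "c \<in> carrier R" "\<And>t. \<alpha> t \<in> carrier R"
  shows "row k \<alpha> i j t (\<lambda>u. v u \<oplus> c \<otimes> w u) = row k \<alpha> i j t v \<oplus> c \<otimes> row k \<alpha> i j t w"
proof -
  have *: "(a \<oplus> c \<otimes> b) \<ominus> (a' \<oplus> c \<otimes> b') = (a \<ominus> a') \<oplus> c \<otimes> (b \<ominus> b')"
    if "a \<in> carrier R" "b \<in> carrier R" "a' \<in> carrier R" "b' \<in> carrier R" for a b a' b'
    using that assms(3) by algebra
  define G where "G v = (if t = i then \<zero>
    else ev (\<lambda>u. v (k + u)) k (\<alpha> (if i < t \<and> t \<le> j then t - 1 else t)))" for v :: "nat \<Rightarrow> 'a"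
  have G: "G v \<in> carrier R" "G w \<in> carrier R" using assms by (simp_all add: G_def)
  have "G (\<lambda>u. v u \<oplus> c \<otimes> w u) = G v \<oplus> c \<otimes> G w"
    using assms(3) by (simp add: G_def ev_add_smult[OF assms(1,2,3,4)])
  moreover have "ev (\<lambda>u. v u \<oplus> c \<otimes> w u) k (\<alpha> t) = ev v k (\<alpha> t) \<oplus> c \<otimes> ev w k (\<alpha> t)"
    by (rule ev_add_smult[OF assms])
  moreover have "row k \<alpha> i j t z = ev z k (\<alpha> t) \<ominus> G z" for z by (simp add: row_def G_def)
  ultimately show ?thesis using * assms(1,2,4) G by simp
qed

text \<open>Column elimination without exchanges: \<open>col t r\<close> is the \<open>r\<close>-th column after \<open>t\<close> steps.\<close>

primrec col :: "nat \<Rightarrow> (nat \<Rightarrow> 'a) \<Rightarrow> nat \<Rightarrow> nat \<Rightarrow> nat \<Rightarrow> nat \<Rightarrow> nat \<Rightarrow> 'a" where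
  "col k \<alpha> i j 0 = (\<lambda>r u. if u = r then \<one> else \<zero>)"
| "col k \<alpha> i j (Suc t) = (\<lambda>r u. col k \<alpha> i j t r u \<oplus>
     (\<ominus> (row k \<alpha> i j t (col k \<alpha> i j t r) \<otimes>
       (if row k \<alpha> i j t (col k \<alpha> i j t t) = \<zero> then \<zero> else inv (row k \<alpha> i j t (col k \<alpha> i j t t)))))
     \<otimes> col k \<alpha> i j t t u)"

text \<open>As long as the earlier pivots are nonzero, this is the quotient of two consecutive
  leading principal minors.\<close>

definition pivot :: "nat \<Rightarrow> (nat \<Rightarrow> 'a) \<Rightarrow> nat \<Rightarrow> nat \<Rightarrow> nat \<Rightarrow> 'a" where
  "pivot k \<alpha> i j t = row k \<alpha> i j t (col k \<alpha> i j t t)"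

section \<open>Triangularity and kernels of the eliminated systems\<close>

lemma col_closed [simp]:
  assumes "\<And>t. \<alpha> t \<in> carrier R"
  shows "col k \<alpha> i j t r u \<in> carrier R"
proof (induction t arbitrary: r u)
  case (Suc t)
  define p where "p = row k \<alpha> i j t (col k \<alpha> i j t t)"
  have "p \<in> carrier R" using Suc assms by (simp add: p_def)
  then have "(if p = \<zero> then \<zero> else inv p) \<in> carrier R" by (simp add: field_Units)
  then show ?case unfolding col.simps p_def[symmetric] using Suc assms by simp
qed simp

lemma pivot_closed [simp]: "(\<And>t. \<alpha> t \<in> carrier R) \<Longrightarrow> pivot k \<alpha> i j t \<in> carrier R"
  by (simp add: pivot_def)

text \<open>Step \<open>t\<close> changes a later column only by a multiple of column
  \<open>t\<close>, whose support ends at \<open>t\<close>; the leading 1 and the zeros behind it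
  stay.\<close>

lemma col_unitriangular:
  assumes "\<And>t. \<alpha> t \<in> carrier R" "t \<le> r"
  shows "r < u \<Longrightarrow> col k \<alpha> i j t r u = \<zero>" and "col k \<alpha> i j t r r = \<one>"
proof -
  have "(r < u \<longrightarrow> col k \<alpha> i j t r u = \<zero>) \<and> col k \<alpha> i j t r r = \<one>" for u
    using assms(2)
  proof (induction t arbitrary: r u)
    case 0
    then show ?case by simp
  next
    case (Suc t)
    have "col k \<alpha> i j t t w = \<zero>" if "t < w" for w using Suc.IH[of t w] that by simp
    then show ?case using Suc.IH[of r] Suc.prems assms(1) by (auto simp: field_Units)
  qed
  then show "r < u \<Longrightarrow> col k \<alpha> i j t r u = \<zero>" and "col k \<alpha> i j t r r = \<one>" by auto
qed

lemma col_cong_points: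
  "(\<And>u. u < t \<Longrightarrow> \<alpha> u = \<beta> u) \<Longrightarrow> col k \<alpha> i j t = col k \<beta> i j t"
proof (induction t)
  case (Suc t)
  then have "row k \<alpha> i j t v = row k \<beta> i j t v" for v by (intro row_cong_points) simp
  with Suc show ?case by simp
qed simp

lemma pivot_cong_points:
  "(\<And>u. u \<le> t \<Longrightarrow> \<alpha> u = \<beta> u) \<Longrightarrow> pivot k \<alpha> i j t = pivot k \<beta> i j t"
  unfolding pivot_def using col_cong_points[of t \<alpha> \<beta>] row_cong_points[of t \<alpha> \<beta>] by simp

text \<open>Step \<open>t'\<close> clears row \<open>t'\<close>, and each later step adds a multiple
  of a column that row \<open>t'\<close> already annihilates.\<close>

lemma row_col:
  assumes \<alpha>: "\<And>t. \<alpha> t \<in> carrier R" and "\<And>r. r < t \<Longrightarrow> pivot k \<alpha> i j r \<noteq> \<zero>" "t' < t" "t \<le> r"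
  shows "row k \<alpha> i j t' (col k \<alpha> i j t r) = \<zero>"
  using assms(2-)
proof (induction t arbitrary: r)
  case (Suc t)
  define p where "p = pivot k \<alpha> i j t"
  define c where "c = \<ominus> (row k \<alpha> i j t (col k \<alpha> i j t r) \<otimes> inv p)"
  have p: "p \<in> carrier R" "p \<noteq> \<zero>" using \<alpha> Suc.prems(1)[of t] by (auto simp: p_def)
  have c: "c \<in> carrier R" using p \<alpha> by (auto simp: c_def field_Units)
  have "col k \<alpha> i j (Suc t) r = (\<lambda>u. col k \<alpha> i j t r u \<oplus> c \<otimes> col k \<alpha> i j t t u)"
    using p by (simp add: c_def p_def pivot_def)
  then have *: "row k \<alpha> i j t' (col k \<alpha> i j (Suc t) r) =
      row k \<alpha> i j t' (col k \<alpha> i j t r) \<oplus> c \<otimes> row k \<alpha> i j t' (col k \<alpha> i j t t)"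
    using \<alpha> c by (simp add: row_add_smult)
  show ?case
  proof (cases "t' = t")
    case True
    have inv: "inv p \<in> carrier R" "inv p \<otimes> p = \<one>" using p by (auto simp: field_Units)
    define x where "x = row k \<alpha> i j t (col k \<alpha> i j t r)"
    have x: "x \<in> carrier R" using \<alpha> by (simp add: x_def)
    have "\<ominus> (x \<otimes> inv p) \<otimes> p = \<ominus> (x \<otimes> (inv p \<otimes> p))" using x p inv(1) by algebra
    then have "\<ominus> (x \<otimes> inv p) \<otimes> p = \<ominus> x" using x inv by simp
    then show ?thesis using * x True by (simp add: r_neg c_def p_def pivot_def x_def)
  next
    case False
    then show ?thesis using * Suc c by simp
  qed
qed simp

text \<open>This is invertibility of the leading d by d block. Subtracting \<open>v d\<close> times
  column \<open>d\<close> removes the last entry and leaves the rows before \<open>d\<close> intact,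
  so by induction \<open>v\<close> is a multiple of that column; row \<open>d\<close> then yields
  \<open>v d\<close> times the pivot.\<close>

lemma kernel_trivial:
  assumes \<alpha>: "\<And>t. \<alpha> t \<in> carrier R" and "\<And>r. r < d \<Longrightarrow> pivot k \<alpha> i j r \<noteq> \<zero>"
    and v: "\<And>u. v u \<in> carrier R" "\<And>u. d \<le> u \<Longrightarrow> v u = \<zero>"
    and "\<And>t. t < d \<Longrightarrow> row k \<alpha> i j t v = \<zero>"
  shows "v u = \<zero>"
  using assms(2-)
proof (induction d arbitrary: v u)
  case (Suc d)
  define b where "b = col k \<alpha> i j d d"
  define c where "c = \<ominus> v d"
  define w where "w = (\<lambda>u. v u \<oplus> c \<otimes> b u)"
  have b: "b u \<in> carrier R" for u using \<alpha> by (simp add: b_def)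
  have c: "c \<in> carrier R" using Suc.prems by (simp add: c_def)
  have "b d = \<one>" "\<And>u. d < u \<Longrightarrow> b u = \<zero>" using col_unitriangular[of \<alpha> d d] \<alpha> by (simp_all add: b_def)
  then have w0: "w u = \<zero>" if "d \<le> u" for u
    using that Suc.prems(2,3) c by (cases "u = d") (auto simp: w_def c_def r_neg)
  have row_w: "row k \<alpha> i j t w = row k \<alpha> i j t v \<oplus> c \<otimes> row k \<alpha> i j t b" for t
    using \<alpha> b c Suc.prems by (simp add: row_add_smult w_def)
  have w: "w u = \<zero>" for u
  proof (rule Suc.IH)
    show "row k \<alpha> i j t w = \<zero>" if "t < d" for t
    proof -
      have "row k \<alpha> i j t b = \<zero>" unfolding b_def using that \<alpha> Suc.prems(1) by (intro row_col) auto
      then show ?thesis using row_w Suc.prems(4) c that by simp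
    qed
  qed (use Suc.prems w0 b c in \<open>auto simp: w_def\<close>)
  have "c \<otimes> row k \<alpha> i j d b = \<zero>"
    using row_w[of d] Suc.prems(4)[of d] w row_zero[of k w \<alpha> i j d] \<alpha> b c by simp
  moreover have "row k \<alpha> i j d b \<noteq> \<zero>" using Suc.prems(1)[of d] by (simp add: pivot_def b_def)
  ultimately have "c = \<zero>" using c b \<alpha> integral[of c "row k \<alpha> i j d b"] by auto
  then show ?case using w[of u] Suc.prems(2)[of u] b[of u] by (simp add: w_def)
qed simp

section \<open>Greedy choice of the evaluation points\<close>

definition good :: "nat \<Rightarrow> (nat \<Rightarrow> 'a) \<Rightarrow> nat \<Rightarrow> bool" where
  "good k \<alpha> n \<longleftrightarrow> inj_on \<alpha> {..<n} \<and>
     (\<forall>i j. i + k \<le> j \<and> j < 2 * k \<longrightarrow> (\<forall>r<n. pivot k \<alpha> i j r \<noteq> \<zero>))"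

text \<open>The \<open>s\<close>-th column is a nonzero solution of the first \<open>s\<close> equations. If it satisfied the next one
  for every new point, then \<open>f\<close> and \<open>g\<close> would have at least \<open>k\<close> zeros among the old points. For
  \<open>s < k\<close> no counting is needed, since then \<open>g = 0\<close> and \<open>f\<close> is monic of degree \<open>s\<close>.\<close>

lemma pivot_polynomial:
  assumes \<alpha>: "\<And>t. \<alpha> t \<in> carrier R" and inj: "inj_on \<alpha> {..<s}"
    and piv: "\<And>r. r < s \<Longrightarrow> pivot k \<alpha> i j r \<noteq> \<zero>"
    and ij: "i + k \<le> j" "j < 2 * k" and s: "s < 2 * k"
  shows "\<exists>v. (\<forall>u. v u \<in> carrier R) \<and> (\<exists>u<k. v u \<noteq> \<zero>) \<and>
    (\<forall>x\<in>carrier R. pivot k (\<alpha>(s := x)) i j s = ev v k x)"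
proof -
  define b where "b = col k \<alpha> i j s s"
  define f where "f = ev b k"
  define g where "g = ev (\<lambda>u. b (k + u)) k"
  define c where "c = g (\<alpha> (s - 1))"
  \<comment> \<open>These are the three cases of \<open>row\<close> read as functions of the new
    point x: f(x), then f(x) - c with c the value of g at the previous point, then f(x) -
    g(x).\<close>
  define v where "v = (if s = i then b else if i < s \<and> s \<le> j then b(0 := b 0 \<ominus> c)
    else (\<lambda>u. b u \<oplus> \<ominus> \<one> \<otimes> b (k + u)))"
  have b: "b u \<in> carrier R" for u using \<alpha> by (simp add: b_def)
  have fg: "f x \<in> carrier R" "g x \<in> carrier R" if "x \<in> carrier R" for x
    using that b by (auto simp: f_def g_def)
  have c: "c \<in> carrier R" using fg \<alpha> by (simp add: c_def)
  have k: "k > 0" using s by simp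
  have vc: "v u \<in> carrier R" for u using b c by (simp add: v_def)
  have bs: "b s = \<one>" "\<And>u. s < u \<Longrightarrow> b u = \<zero>"
    using col_unitriangular[of \<alpha> s s] \<alpha> by (simp_all add: b_def)
  have row_b: "row k \<alpha> i j t b = \<zero>" if "t < s" for t
    unfolding b_def using that \<alpha> piv by (intro row_col) auto
  have pv: "pivot k (\<alpha>(s := x)) i j s = ev v k x" if x: "x \<in> carrier R" for x
  proof -
    have "col k (\<alpha>(s := x)) i j s = col k \<alpha> i j s" by (rule col_cong_points) simp
    then have P: "pivot k (\<alpha>(s := x)) i j s =
        f x \<ominus> (if s = i then \<zero> else g ((\<alpha>(s := x)) (if i < s \<and> s \<le> j then s - 1 else s)))"
      by (simp add: pivot_def row_def f_def g_def b_def)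
    consider "s = i" | "i < s" "s \<le> j" | "s \<noteq> i" "\<not> (i < s \<and> s \<le> j)" by blast
    then show ?thesis
    proof cases
      case 1
      then show ?thesis using P fg[OF x] by (simp add: v_def f_def a_minus_def)
    next
      case 2
      then have "ev v k x = f x \<ominus> c"
        using ev_subtract_const[of b c x k] b c x k by (simp add: v_def f_def)
      moreover have "s - 1 \<noteq> s" using 2 by simp
      ultimately show ?thesis using P 2 by (simp add: c_def)
    next
      case 3
      then have "ev v k x = f x \<oplus> \<ominus> \<one> \<otimes> g x"
        using ev_add_smult[of b "\<lambda>u. b (k + u)" "\<ominus> \<one>" x k] b x by (auto simp: v_def f_def g_def)
      then have "ev v k x = f x \<ominus> g x" using fg[OF x] by (simp add: a_minus_def l_minus)
      then show ?thesis using P 3 by auto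
    qed
  qed
  have "\<exists>u<k. v u \<noteq> \<zero>"
  proof (rule ccontr)
    assume "\<not> ?thesis"
    then have v0: "v u = \<zero>" if "u < k" for u using that by blast
    show False
    proof (cases "s < k")
      case True
      then have bk: "b (k + u) = \<zero>" for u using bs by simp
      have "c = \<zero>" using bk \<alpha> by (simp add: c_def g_def)
      then have "v s = b s" using bk b by (auto simp: v_def a_minus_def)
      then show False using v0[OF True] bs by simp
    next
      case False
      \<comment> \<open>The bounds on \<open>j\<close> give \<open>i < k\<close>, so the normalising
        row \<open>i\<close> is one of the old rows and the case \<open>s = i\<close> is
        excluded.\<close>
      then have "i < s" using ij by simp
      have fi: "f (\<alpha> i) = \<zero>"
        using row_b[OF \<open>i < s\<close>] \<alpha> fg by (simp add: row_def f_def a_minus_def)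
      have eq: "f (\<alpha> t) = g (\<alpha> (if i < t \<and> t \<le> j then t - 1 else t))" if "t < s" "t \<noteq> i" for t
        using row_b[OF that(1)] that(2) \<alpha> fg by (simp add: row_def f_def g_def)
      have "b u = \<zero>" if u: "u < 2 * k" for u
      proof (cases "s \<le> j")
        \<comment> \<open>Here \<open>v\<close> vanishing makes f the constant c, and row
          \<open>i\<close> gives c = 0. The old rows then provide zeros of g at all old points
          except the last, where the value of g is c itself.\<close>
        case True
        have b': "b u = (if u = 0 then c else \<zero>)" if "u < k" for u
          using v0[OF that] True \<open>i < s\<close> b c by (auto simp: v_def split: if_splits)
        have fc: "f x = c" if x: "x \<in> carrier R" for x
        proof -
          have "\<zero> = ev v k x" using v0 x by simp
          also have "\<dots> = f x \<ominus> c"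
            using ev_subtract_const[of b c x k] b c x k True \<open>i < s\<close> by (simp add: v_def f_def)
          finally have "f x \<ominus> c = \<zero>" by (rule sym)
          then show ?thesis by (rule iffD1[OF minus_eq_zero_iff[OF fg(1)[OF x] c]])
        qed
        have "c = \<zero>" using fc[OF \<alpha>] fi by simp
        have "g x = \<zero>" if "x \<in> \<alpha> ` {..<s}" for x
        proof -
          obtain t where t: "x = \<alpha> t" "t < s" using \<open>x \<in> \<alpha> ` {..<s}\<close> by blast
          consider "t < i" | "i \<le> t" "Suc t < s" | "t = s - 1" using t by linarith
          then show ?thesis
          proof cases
            case 1
            then show ?thesis using eq[of t] t fc[OF \<alpha>] \<open>c = \<zero>\<close> by simp
          next
            case 2
            then show ?thesis using eq[of "Suc t"] t fc[OF \<alpha>] \<open>c = \<zero>\<close> True by simp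
          next
            case 3
            then show ?thesis using t \<open>c = \<zero>\<close> by (simp add: c_def)
          qed
        qed
        note g0 = this
        have card: "k \<le> card (\<alpha> ` {..<s})" using \<open>\<not> s < k\<close> by (simp add: card_image[OF inj])
        have "b (k + w) = \<zero>" if "w < k" for w
          by (rule ev_roots[OF b _ _ card _ that]) (use g0 \<alpha> in \<open>auto simp: g_def\<close>)
        from this[of "u - k"] show ?thesis using b'[of u] \<open>c = \<zero>\<close> u by (cases "u < k") auto
      next
        \<comment> \<open>Here f = g, and all rows of the window are old. The shifted rows equate
          the values of f at neighbouring points, so the zero at \<open>\<alpha> i\<close> travels
          up to \<open>\<alpha> j\<close>, through more than k points.\<close>
        case False
        then have vd: "v = (\<lambda>u. b u \<oplus> \<ominus> \<one> \<otimes> b (k + u))" using \<open>i < s\<close> by (simp add: v_def)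
        have same: "b u = b (k + u)" if "u < k" for u
        proof -
          have "b u \<ominus> b (k + u) = \<zero>"
            using v0[OF that] b by (simp add: vd a_minus_def l_minus)
          then show ?thesis by (rule iffD1[OF minus_eq_zero_iff[OF b b]])
        qed
        have fg_eq: "f x = g x" for x unfolding f_def g_def by (rule ev_cong) (rule same)
        have "f (\<alpha> (i + t)) = \<zero>" if "t \<le> j - i" for t
          using that
        proof (induction t)
          case (Suc t)
          then have "i + Suc t \<le> j" by linarith
          then have "f (\<alpha> (i + Suc t)) = g (\<alpha> (i + t))"
            using eq[of "i + Suc t"] False by simp
          then show ?case using Suc fg_eq by simp
        qed (simp add: fi)
        then have f0: "f (\<alpha> (i + (t - i))) = \<zero>" if "t \<le> j" for t
          using that by (simp only: diff_le_mono)
        have f0: "f x = \<zero>" if "x \<in> \<alpha> ` {i..j}" for x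
        proof -
          obtain t where "x = \<alpha> t" "i \<le> t" "t \<le> j" using \<open>x \<in> \<alpha> ` {i..j}\<close> by auto
          then show ?thesis using f0[of t] by simp
        qed
        have inj': "inj_on \<alpha> {i..j}" using inj False by (auto intro: inj_on_subset)
        have card: "k \<le> card (\<alpha> ` {i..j})" using ij by (simp add: card_image[OF inj'])
        have bw: "b w = \<zero>" if "w < k" for w
          by (rule ev_roots[OF b _ _ card _ that]) (use f0 \<alpha> in \<open>auto simp: f_def\<close>)
        show ?thesis
        proof (cases "u < k")
          case False
          with u have "u - k < k" "u = k + (u - k)" by auto
          then show ?thesis using bw same by metis
        qed (rule bw)
      qed
      from this[of s] show False using bs s by simp
    qed
  qed
  with vc pv show ?thesis by blast
qed

text \<open>The size hypothesis counts the excluded elements: at most \<open>2 * k\<close> old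
  points, and at most \<open>k\<close> zeros of the next pivot for each of at most
  \<open>k * (2 * k)\<close> pairs.\<close>

lemma good_extend:
  assumes \<alpha>: "\<And>t. \<alpha> t \<in> carrier R" and good: "good k \<alpha> s" and s: "s < 2 * k"
    and fin: "finite (carrier R)" and card: "2 * k + k * (2 * k) * k < card (carrier R)"
  shows "\<exists>x\<in>carrier R. good k (\<alpha>(s := x)) (Suc s)"
proof -
  define W where "W = {(i, j). i + k \<le> j \<and> j < 2 * k}"
  define Z where "Z = (\<lambda>(i, j). {x \<in> carrier R. pivot k (\<alpha>(s := x)) i j s = \<zero>})"
  have W: "W \<subseteq> {..<k} \<times> {..<2 * k}" by (auto simp: W_def)
  then have finW: "finite W" by (rule finite_subset) simp
  have "card W \<le> k * (2 * k)" using card_mono[OF _ W] by simp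
  have Z: "card (Z w) \<le> k" if "w \<in> W" for w
  proof (rule ccontr)
    obtain i j where w: "w = (i, j)" "i + k \<le> j" "j < 2 * k" using \<open>w \<in> W\<close> unfolding W_def by blast
    assume "\<not> ?thesis"
    then have *: "k \<le> card (Z w)" by simp
    have "inj_on \<alpha> {..<s}" "\<And>r. r < s \<Longrightarrow> pivot k \<alpha> i j r \<noteq> \<zero>" using good w by (auto simp: good_def)
    from pivot_polynomial[OF \<alpha> this w(2,3) s] obtain v u where
      v: "\<forall>u. v u \<in> carrier R" "u < k" "v u \<noteq> \<zero>" "\<forall>x\<in>carrier R. pivot k (\<alpha>(s := x)) i j s = ev v k x"
      by blast
    have "v u = \<zero>" using v fin * by (intro ev_roots[of v "Z w" k u]) (auto simp: Z_def w(1))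
    then show False using v by simp
  qed
  define Bad where "Bad = \<alpha> ` {..<s} \<union> \<Union> (Z ` W)"
  have "card (\<Union> (Z ` W)) \<le> (\<Sum>w\<in>W. card (Z w))" by (rule card_UN_le[OF finW])
  also have "\<dots> \<le> card W * k" using sum_bounded_above[of W "\<lambda>w. card (Z w)" k] Z by simp
  also have "\<dots> \<le> k * (2 * k) * k" using \<open>card W \<le> _\<close> by (rule mult_right_mono) simp
  finally have "card Bad \<le> 2 * k + k * (2 * k) * k"
    unfolding Bad_def using card_Un_le[of "\<alpha> ` {..<s}" "\<Union> (Z ` W)"] card_image_le[of "{..<s}" \<alpha>] s
    by simp
  moreover have "finite Bad" unfolding Bad_def using finW fin by (auto simp: Z_def)
  ultimately have "\<not> carrier R \<subseteq> Bad" using card card_mono[of Bad "carrier R"] by linarith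
  then obtain x where x: "x \<in> carrier R" "x \<notin> Bad" by blast
  have "inj_on (\<alpha>(s := x)) {..<Suc s}"
    using good x by (auto simp: good_def Bad_def inj_on_def less_Suc_eq)
  moreover have "pivot k (\<alpha>(s := x)) i j r \<noteq> \<zero>" if "i + k \<le> j" "j < 2 * k" "r < Suc s" for i j r
  proof (cases "r = s")
    case True
    then show ?thesis using x that by (auto simp: Bad_def W_def Z_def)
  next
    case False
    then have "pivot k (\<alpha>(s := x)) i j r = pivot k \<alpha> i j r"
      using that by (intro pivot_cong_points) auto
    then show ?thesis using good that False by (simp add: good_def)
  qed
  ultimately show ?thesis using x by (auto simp: good_def)
qed

section \<open>From nonzero pivots to error correction\<close>

lemma good_imp_equal:
  assumes \<alpha>: "\<And>t. \<alpha> t \<in> carrier R" and good: "good k \<alpha> (2 * k)"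
    and vw: "\<And>u. v u \<in> carrier R" "\<And>u. w u \<in> carrier R" and ij: "i \<le> j" "j < 2 * k"
    and eq1: "\<And>t. t < 2 * k \<Longrightarrow> t < i \<or> j < t \<Longrightarrow> ev v k (\<alpha> t) = ev w k (\<alpha> t)"
    and eq2: "\<And>t. i < t \<Longrightarrow> t \<le> j \<Longrightarrow> ev v k (\<alpha> t) = ev w k (\<alpha> (t - 1))"
    and x: "x \<in> carrier R"
  shows "ev v k x = ev w k x"
proof (cases "i + k \<le> j")
  case True
  \<comment> \<open>For a distant pair, subtracting c from both polynomials makes row
    \<open>i\<close> hold and preserves the other equations; the concatenated vector then lies in a
    trivial kernel.\<close>
  define c where "c = ev v k (\<alpha> i)"
  define z where "z = (\<lambda>u. if u < k then (v(0 := v 0 \<ominus> c)) u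
    else if u < 2 * k then (w(0 := w 0 \<ominus> c)) (u - k) else \<zero>)"
  have c: "c \<in> carrier R" using vw \<alpha> by (simp add: c_def)
  have k: "k > 0" using ij by simp
  have z: "z u \<in> carrier R" for u using vw c by (simp add: z_def)
  have evz: "ev z k x = ev v k x \<ominus> c" "ev (\<lambda>u. z (k + u)) k x = ev w k x \<ominus> c"
    if "x \<in> carrier R" for x
  proof -
    have "ev z k x = ev (v(0 := v 0 \<ominus> c)) k x" by (rule ev_cong) (simp add: z_def)
    then show "ev z k x = ev v k x \<ominus> c" using ev_subtract_const[of v c x k] vw c k that by simp
    have "ev (\<lambda>u. z (k + u)) k x = ev (w(0 := w 0 \<ominus> c)) k x" by (rule ev_cong) (simp add: z_def)
    then show "ev (\<lambda>u. z (k + u)) k x = ev w k x \<ominus> c"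
      using ev_subtract_const[of w c x k] vw c k that by simp
  qed
  have "z u = \<zero>" for u
  proof (rule kernel_trivial[OF \<alpha>])
    show "pivot k \<alpha> i j r \<noteq> \<zero>" if "r < 2 * k" for r
      using good that True ij by (auto simp: good_def)
    show "z u = \<zero>" if "2 * k \<le> u" for u using that by (simp add: z_def)
    show "row k \<alpha> i j t z = \<zero>" if "t < 2 * k" for t
    proof -
      have [simp]: "ev v k (\<alpha> t) \<in> carrier R" "ev w k (\<alpha> t) \<in> carrier R" for t using vw \<alpha> by auto
      consider "t = i" | "i < t" "t \<le> j" | "t < i \<or> j < t" by linarith
      then show ?thesis
      proof cases
        case 1
        then show ?thesis using \<alpha> c vw by (simp add: row_def evz c_def minus_eq_zero_iff)
      next
        case 2
        then show ?thesis using \<alpha> c eq2[OF 2] by (simp add: row_def evz minus_eq_zero_iff)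
      next
        case 3
        then have "t \<noteq> i" "\<not> (i < t \<and> t \<le> j)" using ij by auto
        then show ?thesis using \<alpha> c eq1[OF that 3] by (auto simp: row_def evz minus_eq_zero_iff)
      qed
    qed
  qed (rule z)
  then have "ev v k x \<ominus> c = \<zero>" "ev w k x \<ominus> c = \<zero>"
    unfolding evz[OF x, symmetric] using x by simp_all
  then show ?thesis using vw c x by (simp add: minus_eq_zero_iff)
next
  \<comment> \<open>For a close pair the block from \<open>i\<close> to \<open>j\<close> has at most
    k positions, and the words agree without a shift on the at least k positions outside it.\<close>
  case False
  define z where "z = (\<lambda>u. v u \<oplus> \<ominus> \<one> \<otimes> w u)"
  have z: "z u \<in> carrier R" for u using vw by (simp add: z_def)
  have evz: "ev z k x = ev v k x \<ominus> ev w k x" if "x \<in> carrier R" for x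
    using ev_add_smult[of v w "\<ominus> \<one>" x k] vw that by (simp add: z_def a_minus_def l_minus)
  define T where "T = {..<2 * k} - {i..j}"
  have "card T = 2 * k - card {i..j}" unfolding T_def using ij by (subst card_Diff_subset) auto
  then have T: "k \<le> card T" using False by simp
  have "inj_on \<alpha> T" using good by (auto simp: good_def T_def intro: inj_on_subset)
  moreover have "ev z k (\<alpha> t) = \<zero>" if "t \<in> T" for t
  proof -
    have "ev v k (\<alpha> t) = ev w k (\<alpha> t)" using eq1[of t] that by (auto simp: T_def not_le)
    then show ?thesis using evz[OF \<alpha>] vw \<alpha> by (simp add: minus_eq_zero_iff)
  qed
  ultimately have "z u = \<zero>" if "u < k" for u
    using z \<alpha> T that by (intro ev_roots[of z "\<alpha> ` T" k u]) (auto simp: card_image T_def)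
  then have "ev v k x \<ominus> ev w k x = \<zero>" unfolding evz[OF x, symmetric] using x by simp
  then show ?thesis using vw x by (simp add: minus_eq_zero_iff)
qed

lemma good_corrects:
  assumes \<alpha>: "\<And>t. \<alpha> t \<in> carrier R" and good: "good k \<alpha> (2 * k)"
  shows "corrects_single_insdel A (rs_code R k (map \<alpha> [0..<2 * k]))"
proof -
  define C where "C = rs_code R k (map \<alpha> [0..<2 * k])"
  have len: "length c = 2 * k" if "c \<in> C" for c using that by (auto simp: C_def rs_code_def)
  have code: "\<exists>v. (\<forall>u. v u \<in> carrier R) \<and> c = map (\<lambda>t. ev v k (\<alpha> t)) [0..<2 * k]" if "c \<in> C" for c
  proof -
    obtain f where f: "c = map (eval f) (map \<alpha> [0..<2 * k])" "polynomial (carrier R) f"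
      "f = [] \<or> degree f < k"
      using \<open>c \<in> C\<close> unfolding C_def rs_code_def by blast
    from polynomial_eval_ev[OF f(2,3)] obtain v where "\<forall>u. v u \<in> carrier R"
      "\<forall>x\<in>carrier R. eval f x = ev v k x" by blast
    then show ?thesis using f(1) \<alpha> by (intro exI[of _ v]) auto
  qed
  \<comment> \<open>The deleted positions are the lengths of the two prefixes; the opposite order of
    the lengths follows by exchanging the words.\<close>
  have main: "us @ a # vs = us' @ a' # vs'"
    if c: "us @ a # vs \<in> C" "us' @ a' # vs' \<in> C" and eq: "us @ vs = us' @ vs'"
      and le: "length us \<le> length us'" for us vs us' vs' and a a' :: 'a
  proof -
    define i where "i = length us"
    define j where "j = length us'"
    obtain v where v: "\<forall>u. v u \<in> carrier R" "us @ a # vs = map (\<lambda>t. ev v k (\<alpha> t)) [0..<2 * k]"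
      using code[OF c(1)] by blast
    obtain w where w: "\<forall>u. w u \<in> carrier R" "us' @ a' # vs' = map (\<lambda>t. ev w k (\<alpha> t)) [0..<2 * k]"
      using code[OF c(2)] by blast
    have vt: "ev v k (\<alpha> t) = (us @ a # vs) ! t" "ev w k (\<alpha> t) = (us' @ a' # vs') ! t" if "t < 2 * k" for t
      using that unfolding v(2) w(2) by simp_all
    have L: "Suc (length us + length vs) = 2 * k" "Suc (length us' + length vs') = 2 * k"
      using len[OF c(1)] len[OF c(2)] by simp_all
    have ij: "i \<le> j" "j < 2 * k" using le L by (auto simp: i_def j_def)
    have zs: "(us @ vs) ! t = (us' @ vs') ! t" for t using eq by simp
    have del: "(xs @ b # ys) ! t = (xs @ ys) ! (if t < length xs then t else t - 1)"
      if "t \<noteq> length xs" for xs ys t and b :: 'a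
      using that by (auto simp: nth_append nth_Cons' )
    have "ev v k x = ev w k x" if x: "x \<in> carrier R" for x
    proof (rule good_imp_equal[OF \<alpha> good _ _ ij _ _ x])
      show "ev v k (\<alpha> t) = ev w k (\<alpha> t)" if "t < 2 * k" "t < i \<or> j < t" for t
        using that ij zs by (auto simp: vt del i_def j_def)
      show "ev v k (\<alpha> t) = ev w k (\<alpha> (t - 1))" if "i < t" "t \<le> j" for t
        using that ij zs by (auto simp: vt del i_def j_def)
    qed (use v w in auto)
    then show ?thesis unfolding v(2) w(2) using \<alpha> by simp
  qed
  have "lcs c c' + 2 \<le> 2 * k" if c: "c \<in> C" "c' \<in> C" "c \<noteq> c'" for c c'
  proof (rule ccontr)
    assume "\<not> ?thesis"
    then have "2 * k - 1 \<le> lcs c c'" by simp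
    then obtain zs0 where zs0: "subseq zs0 c" "subseq zs0 c'" "2 * k - 1 \<le> length zs0"
      by (auto simp: lcs_ge_iff)
    define zs where "zs = take (2 * k - 1) zs0"
    have zs: "subseq zs c" "subseq zs c'" "length zs = 2 * k - 1"
      using zs0 by (simp_all add: zs_def subseq_shorten)
    have "k > 0" using c len[of c] len[of c'] by (cases k) auto
    then have "length c = Suc (length zs)" "length c' = Suc (length zs)"
      using zs c len by auto
    with zs obtain us a vs us' a' vs' where
      "c = us @ a # vs" "zs = us @ vs" "c' = us' @ a' # vs'" "zs = us' @ vs'"
      using subseq_length_Suc_imp_delete[of zs c] subseq_length_Suc_imp_delete[of zs c'] by metis
    then show False
      using main[of us a vs us' a' vs'] main[of us' a' vs' us a vs] c le_cases[of "length us" "length us'"]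
      by metis
  qed
  moreover have "corrects_single_insdel A C \<longleftrightarrow> (\<forall>c\<in>C. \<forall>c'\<in>C. c \<noteq> c' \<longrightarrow> lcs c c' + 2 \<le> 2 * k)"
    using len by (rule corrects_single_insdel_iff_lcs)
  ultimately show ?thesis unfolding C_def by blast
qed

end


section \<open>Total correctness with a cost bound\<close>

primrec mods :: "com \<Rightarrow> nat set" where
  "mods Skip = {}"
| "mods (Assign x e) = {x}"
| "mods (AssignArr a i e) = {}"
| "mods (Seq c1 c2) = mods c1 \<union> mods c2"
| "mods (Cond b c1 c2) = mods c1 \<union> mods c2"
| "mods (While b c) = mods c"

primrec amods :: "com \<Rightarrow> nat set" where
  "amods Skip = {}"
| "amods (Assign x e) = {}"
| "amods (AssignArr a i e) = {a}"
| "amods (Seq c1 c2) = amods c1 \<union> amods c2"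
| "amods (Cond b c1 c2) = amods c1 \<union> amods c2"
| "amods (While b c) = amods c"

text \<open>Frames carry facts about untouched variables and arrays through a loop, so that
  invariants need mention only what changes.\<close>

definition frame :: "com \<Rightarrow> store \<Rightarrow> store \<Rightarrow> bool" where
  "frame c s s' \<longleftrightarrow> (\<forall>x. x \<notin> mods c \<longrightarrow> fst s' x = fst s x) \<and>
     (\<forall>a. a \<notin> amods c \<longrightarrow> snd s' a = snd s a)"

lemma frame_trans: "frame c s s' \<Longrightarrow> frame c s' s'' \<Longrightarrow> frame c s s''"
  by (simp add: frame_def)

lemma frame_mono: "frame c s s' \<Longrightarrow> mods c \<subseteq> mods d \<Longrightarrow> amods c \<subseteq> amods d \<Longrightarrow> frame d s s'"
  by (auto simp: frame_def)

lemma exec_frame: "exec F c s t s' \<Longrightarrow> frame c s s'"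
  by (induction rule: exec.induct) (auto simp: frame_def)

text \<open>With \<open>L\<close> bounding the iterations of every loop, the cost is a polynomial in
  \<open>L\<close> read off the syntax. Branches are added rather than maximised, so that sums and
  products with \<open>L\<close> cover all clauses.\<close>

primrec cost_bound :: "nat \<Rightarrow> com \<Rightarrow> nat" where
  "cost_bound L Skip = 1"
| "cost_bound L (Assign x e) = 1 + acost e"
| "cost_bound L (AssignArr a i e) = 1 + acost i + acost e"
| "cost_bound L (Seq c1 c2) = 1 + cost_bound L c1 + cost_bound L c2"
| "cost_bound L (Cond b c1 c2) = 1 + bcost b + cost_bound L c1 + cost_bound L c2"
| "cost_bound L (While b c) = L * (1 + bcost b + cost_bound L c) + (1 + bcost b)"

text \<open>Adding the exponents is crude but avoids maxima; it is sound because \<open>L\<close> is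
  at least 1.\<close>

lemma poly_bound_add:
  fixes f g :: "nat \<Rightarrow> nat"
  assumes "\<forall>L\<ge>1. f L \<le> a * L ^ d" "\<forall>L\<ge>1. g L \<le> b * L ^ e"
  shows "\<forall>L\<ge>1. f L + g L \<le> (a + b) * L ^ (d + e)"
proof (intro allI impI)
  fix L :: nat assume L: "1 \<le> L"
  have "f L \<le> a * L ^ d" "g L \<le> b * L ^ e" using assms L by auto
  moreover have "a * L ^ d \<le> a * L ^ (d + e)" "b * L ^ e \<le> b * L ^ (d + e)"
    using L by (intro mult_le_mono2 power_increasing; simp)+
  ultimately have "f L \<le> a * L ^ (d + e)" "g L \<le> b * L ^ (d + e)" by linarith+
  then show "f L + g L \<le> (a + b) * L ^ (d + e)" by (simp add: add_mult_distrib)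
qed

lemma cost_bound_polynomial: "\<exists>a d. \<forall>L\<ge>1. cost_bound L c \<le> a * L ^ d"
proof (induction c)
  case (Seq c1 c2)
  then obtain a d b e where *: "\<forall>L\<ge>1. cost_bound L c1 \<le> a * L ^ d" "\<forall>L\<ge>1. cost_bound L c2 \<le> b * L ^ e"
    by blast
  have "\<forall>L\<ge>1. 1 \<le> 1 * (L::nat) ^ 0" by simp
  from poly_bound_add[OF poly_bound_add[OF this *(1)] *(2)] show ?case
    unfolding cost_bound.simps by blast
next
  case (Cond x c1 c2)
  then obtain a d b e where *: "\<forall>L\<ge>1. cost_bound L c1 \<le> a * L ^ d" "\<forall>L\<ge>1. cost_bound L c2 \<le> b * L ^ e"
    by blast
  have "\<forall>L\<ge>1. 1 + bcost x \<le> (1 + bcost x) * (L::nat) ^ 0" by simp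
  from poly_bound_add[OF poly_bound_add[OF this *(1)] *(2)] show ?case
    unfolding cost_bound.simps by blast
next
  case (While b c)
  then obtain a d where *: "\<forall>L\<ge>1. cost_bound L c \<le> a * L ^ d" by blast
  have c: "\<forall>L\<ge>1. 1 + bcost b \<le> (1 + bcost b) * (L::nat) ^ 0" by simp
  from poly_bound_add[OF c *] obtain a' d' where
    *: "\<forall>L\<ge>1. 1 + bcost b + cost_bound L c \<le> a' * L ^ d'" by blast
  have "\<forall>L\<ge>1. L * (1 + bcost b + cost_bound L c) \<le> a' * L ^ Suc d'"
  proof (intro allI impI)
    fix L :: nat assume "1 \<le> L"
    with * have "L * (1 + bcost b + cost_bound L c) \<le> L * (a' * L ^ d')"
      by (intro mult_le_mono2) blast
    then show "L * (1 + bcost b + cost_bound L c) \<le> a' * L ^ Suc d'" by (simp add: mult.left_commute)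
  qed
  from poly_bound_add[OF this c] show ?case unfolding cost_bound.simps by blast
next
  case Skip
  show ?case by (rule exI[of _ 1], rule exI[of _ 0]) simp
next
  case (Assign x e)
  show ?case by (rule exI[of _ "1 + acost e"], rule exI[of _ 0]) simp
next
  case (AssignArr x i e)
  show ?case by (rule exI[of _ "1 + acost i + acost e"], rule exI[of _ 0]) simp
qed

text \<open>Total correctness for runs whose loops make at most \<open>L\<close> iterations each.\<close>

definition run :: "nat ring \<Rightarrow> nat \<Rightarrow> com \<Rightarrow> store \<Rightarrow> (store \<Rightarrow> bool) \<Rightarrow> bool" where
  "run F L c s Q \<longleftrightarrow> (\<exists>t s'. exec F c s t s' \<and> t \<le> cost_bound L c \<and> Q s')"

lemma runI: "exec F c s t s' \<Longrightarrow> t \<le> cost_bound L c \<Longrightarrow> Q s' \<Longrightarrow> run F L c s Q"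
  unfolding run_def by blast

lemma runE:
  assumes "run F L c s Q"
  obtains t s' where "exec F c s t s'" "t \<le> cost_bound L c" "Q s'"
  using assms unfolding run_def by blast

lemma run_conseq:
  "run F L c s Q \<Longrightarrow> (\<And>s'. Q s' \<Longrightarrow> frame c s s' \<Longrightarrow> Q' s') \<Longrightarrow> run F L c s Q'"
  by (metis runE runI exec_frame)

lemma run_Skip: "Q s \<Longrightarrow> run F L Skip s Q"
  by (rule runI[OF exec.Skip]) simp_all

lemma run_Assign: "Q ((fst s)(x := aval F s e), snd s) \<Longrightarrow> run F L (Assign x e) s Q"
  by (rule runI[OF exec.Assign]) simp_all

lemma run_AssignArr:
  "Q (fst s, (snd s)(a := (snd s a)(aval F s i := aval F s e))) \<Longrightarrow> run F L (AssignArr a i e) s Q"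
  by (rule runI[OF exec.AssignArr]) simp_all

lemma run_Seq:
  assumes "run F L c1 s Q1" "\<And>s'. Q1 s' \<Longrightarrow> frame c1 s s' \<Longrightarrow> run F L c2 s' Q"
  shows "run F L (Seq c1 c2) s Q"
proof -
  obtain t1 s1 where 1: "exec F c1 s t1 s1" "t1 \<le> cost_bound L c1" "Q1 s1"
    using assms(1) by (rule runE)
  then have "run F L c2 s1 Q" using assms(2) exec_frame by blast
  then obtain t2 s2 where 2: "exec F c2 s1 t2 s2" "t2 \<le> cost_bound L c2" "Q s2"
    by (rule runE)
  show ?thesis by (rule runI[OF exec.Seq[OF 1(1) 2(1)]]) (use 1 2 in simp_all)
qed

lemma run_Seq_Assign:
  assumes "run F L c ((fst s)(x := aval F s e), snd s) Q"
  shows "run F L (Seq (Assign x e) c) s Q"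
  by (rule run_Seq[where ?Q1.0 = "\<lambda>s'. s' = ((fst s)(x := aval F s e), snd s)"])
    (rule run_Assign[OF refl], use assms in simp)

lemma run_Seq_AssignArr:
  assumes "run F L c (fst s, (snd s)(a := (snd s a)(aval F s i := aval F s e))) Q"
  shows "run F L (Seq (AssignArr a i e) c) s Q"
  by (rule run_Seq[where ?Q1.0 = "\<lambda>s'. s' = (fst s, (snd s)(a := (snd s a)(aval F s i := aval F s e)))"])
    (rule run_AssignArr[OF refl], use assms in simp)

lemma run_Cond:
  assumes "bval F s b \<Longrightarrow> run F L c1 s Q" "\<not> bval F s b \<Longrightarrow> run F L c2 s Q"
  shows "run F L (Cond b c1 c2) s Q"
proof (cases "bval F s b")
  case True
  obtain t s' where "exec F c1 s t s'" "t \<le> cost_bound L c1" "Q s'"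
    using assms(1)[OF True] by (rule runE)
  then show ?thesis by (intro runI[OF exec.CondTrue[OF True]]) auto
next
  case False
  obtain t s' where "exec F c2 s t s'" "t \<le> cost_bound L c2" "Q s'"
    using assms(2)[OF False] by (rule runE)
  then show ?thesis by (intro runI[OF exec.CondFalse[OF False]]) auto
qed

lemma run_Cond_Assign:
  assumes "Q ((fst s)(x := if bval F s b then aval F s e1 else aval F s e2), snd s)"
  shows "run F L (Cond b (Assign x e1) (Assign x e2)) s Q"
  by (rule run_Cond; rule run_Assign) (use assms in simp_all)

lemma run_Seq_Cond_Assign:
  assumes "run F L c ((fst s)(x := if bval F s b then aval F s e1 else aval F s e2), snd s) Q"
  shows "run F L (Seq (Cond b (Assign x e1) (Assign x e2)) c) s Q"
  by (rule run_Seq[where ?Q1.0 = "\<lambda>s'. s' =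
        ((fst s)(x := if bval F s b then aval F s e1 else aval F s e2), snd s)"])
    (rule run_Cond_Assign[OF refl], use assms in simp)

text \<open>Indexing the invariant by the number of completed rounds, with the exact total
  \<open>N\<close> known, gives termination and the cost bound at once.\<close>

lemma run_While:
  assumes "N \<le> L" "I 0 s"
    and step: "\<And>m s'. m < N \<Longrightarrow> I m s' \<Longrightarrow> bval F s' b \<and> run F L c s' (I (Suc m))"
    and stop: "\<And>s'. I N s' \<Longrightarrow> \<not> bval F s' b"
  shows "run F L (While b c) s (I N)"
proof -
  define B where "B = 1 + bcost b + cost_bound L c"
  have "\<exists>t s'. exec F (While b c) s t s' \<and> t \<le> n * B + (1 + bcost b) \<and> I N s'"
    if "n \<le> N" "I (N - n) s" for n s
    using that
  proof (induction n arbitrary: s)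
    case 0
    then have "I N s" by simp
    then show ?case using exec.WhileFalse[OF stop[OF \<open>I N s\<close>]]
      by (intro exI[of _ "1 + bcost b"] exI[of _ s]) simp
  next
    case (Suc n)
    then have b: "bval F s b" and "run F L c s (I (N - n))"
      using step[of "N - Suc n" s] by (simp_all add: Suc_diff_Suc)
    from this(2) obtain t s' where 1: "exec F c s t s'" "t \<le> cost_bound L c" "I (N - n) s'"
      by (rule runE)
    obtain t' s'' where 2: "exec F (While b c) s' t' s''" "t' \<le> n * B + (1 + bcost b)" "I N s''"
      using Suc.IH[of s'] Suc.prems(1) 1(3) by auto
    have "exec F (While b c) s (1 + bcost b + t + t') s''" by (rule exec.WhileTrue[OF b 1(1) 2(1)])
    then show ?case using 1 2 by (intro exI[of _ "1 + bcost b + t + t'"] exI[of _ s'']) (simp add: B_def)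
  qed
  from this[of N s] obtain t s' where "exec F (While b c) s t s'" "t \<le> N * B + (1 + bcost b)" "I N s'"
    using assms(2) by auto
  moreover have "N * B \<le> L * B" using assms(1) by simp
  ultimately show ?thesis by (intro runI[of F _ s t s']) (simp_all add: B_def)
qed

definition For :: "nat \<Rightarrow> aexp \<Rightarrow> com \<Rightarrow> com" where
  "For x e c = Seq (Assign x (Const 0))
     (While (Less (Var x) e) (Seq c (Assign x (Plus (Var x) (Const 1)))))"

lemma mods_For [simp]: "mods (For x e c) = insert x (mods c)"
  by (auto simp: For_def)

lemma amods_For [simp]: "amods (For x e c) = amods c"
  by (auto simp: For_def)

text \<open>The invariant must tolerate any value of the loop variable, since it has to survive both
  the initialisation and the increment.\<close>

lemma run_For:
  assumes "N \<le> L" "x \<notin> mods c"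
    and e: "\<And>s'. frame (For x e c) s s' \<Longrightarrow> aval F s' e = N"
    and I0: "I 0 s"
    and Ix: "\<And>m s' v. I m s' \<Longrightarrow> I m ((fst s')(x := v), snd s')"
    and step: "\<And>m s'. m < N \<Longrightarrow> I m s' \<Longrightarrow> fst s' x = m \<Longrightarrow> frame (For x e c) s s' \<Longrightarrow>
      run F L c s' (I (Suc m))"
  shows "run F L (For x e c) s (I N)"
proof -
  define J where "J m s' \<longleftrightarrow> I m s' \<and> fst s' x = m \<and> frame (For x e c) s s'" for m s'
  have "run F L (For x e c) s (J N)"
    unfolding For_def
  proof (rule run_Seq_Assign, rule run_While)
    show "J 0 ((fst s)(x := aval F s (Const 0)), snd s)"
      using Ix[OF I0] by (simp add: J_def frame_def)
    fix m s' assume m: "m < N" and J: "J m s'"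
    have "run F L (Seq c (Assign x (Plus (Var x) (Const 1)))) s' (J (Suc m))"
    proof (rule run_Seq)
      show "run F L c s' (I (Suc m))" using step m J by (simp add: J_def)
      fix s'' assume I: "I (Suc m) s''" and fr: "frame c s' s''"
      have "fst s'' x = m" using fr J assms(2) by (simp add: frame_def J_def)
      moreover have "frame (For x e c) s s''"
        using fr J frame_trans[of "For x e c" s s' s''] frame_mono[OF fr, of "For x e c"]
        by (auto simp: J_def)
      ultimately show "run F L (Assign x (Plus (Var x) (Const 1))) s'' (J (Suc m))"
        using Ix[OF I] by (intro run_Assign) (simp add: J_def frame_def)
    qed
    then show "bval F s' (Less (Var x) e) \<and>
        run F L (Seq c (Assign x (Plus (Var x) (Const 1)))) s' (J (Suc m))"
      using J e m by (simp add: J_def)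
  next
    fix s' assume "J N s'"
    then show "\<not> bval F s' (Less (Var x) e)" using e by (simp add: J_def)
  qed (rule assms(1))
  then show ?thesis by (rule run_conseq) (simp add: J_def)
qed


section \<open>The program\<close>

text \<open>\<open>Abase\<close> stores the finished columns one after another, with read pointer \<open>Vp\<close> and write
  pointer \<open>Ve\<close>, since multiplication of indices is not available.\<close>

abbreviation (input) Vk :: nat where "Vk \<equiv> 0"
abbreviation (input) Vs :: nat where "Vs \<equiv> 2"
abbreviation (input) Vx :: nat where "Vx \<equiv> 3"
abbreviation (input) Vok :: nat where "Vok \<equiv> 4"
abbreviation (input) Vi :: nat where "Vi \<equiv> 5"
abbreviation (input) Vj :: nat where "Vj \<equiv> 6"
abbreviation (input) Vr :: nat where "Vr \<equiv> 7"
abbreviation (input) Vt :: nat where "Vt \<equiv> 8"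
abbreviation (input) Vu :: nat where "Vu \<equiv> 9"
abbreviation (input) Vy :: nat where "Vy \<equiv> 10"
abbreviation (input) Vpf :: nat where "Vpf \<equiv> 11"
abbreviation (input) Vpg :: nat where "Vpg \<equiv> 12"
abbreviation (input) Vxf :: nat where "Vxf \<equiv> 13"
abbreviation (input) Vxg :: nat where "Vxg \<equiv> 14"
abbreviation (input) Vc :: nat where "Vc \<equiv> 15"
abbreviation (input) Vp :: nat where "Vp \<equiv> 16"
abbreviation (input) Ve :: nat where "Ve \<equiv> 17"
abbreviation (input) Vd :: nat where "Vd \<equiv> 18"

abbreviation (input) Apts :: nat where "Apts \<equiv> 0"
abbreviation (input) Acur :: nat where "Acur \<equiv> 2"
abbreviation (input) Abase :: nat where "Abase \<equiv> 3"
abbreviation (input) Apiv :: nat where "Apiv \<equiv> 4"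

abbreviation (input) Seq_infix :: "com \<Rightarrow> com \<Rightarrow> com" (infixr ";;" 60) where
  "c ;; d \<equiv> Seq c d"

text \<open>In row \<open>i\<close> the powers for g start at zero and hence stay zero, which
  removes the g part without a branch inside the loop.\<close>

definition Row :: "nat \<Rightarrow> com" where
  "Row \<tau> =
     Assign Vpf FOne ;;
     Assign Vxf (Arr Apts (Var \<tau>)) ;;
     Cond (Equal (Var \<tau>) (Var Vi)) (Assign Vpg FZero) (Assign Vpg FOne) ;;
     Cond (Conj (Less (Var Vi) (Var \<tau>)) (Neg (Less (Var Vj) (Var \<tau>))))
       (Assign Vxg (Arr Apts (Minus (Var \<tau>) (Const 1))))
       (Assign Vxg (Arr Apts (Var \<tau>))) ;;
     Assign Vy FZero ;;
     For Vu (Var Vk)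
       (Assign Vy (FAdd (Var Vy) (FAdd (FMul (Arr Acur (Var Vu)) (Var Vpf))
          (FNeg (FMul (Arr Acur (Plus (Var Vk) (Var Vu))) (Var Vpg))))) ;;
        Assign Vpf (FMul (Var Vpf) (Var Vxf)) ;;
        Assign Vpg (FMul (Var Vpg) (Var Vxg)))"

definition Eliminate :: com where
  "Eliminate =
     Row Vt ;;
     Assign Vc (FNeg (FMul (Var Vy) (FInv (Arr Apiv (Var Vt))))) ;;
     For Vu (Plus (Var Vk) (Var Vk))
       (AssignArr Acur (Var Vu)
          (FAdd (Arr Acur (Var Vu)) (FMul (Var Vc) (Arr Abase (Var Vp)))) ;;
        Assign Vp (Plus (Var Vp) (Const 1)))"

text \<open>The elimination is left-looking: column r undergoes all steps \<open>t < r\<close> in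
  one go, so only finished columns and their pivots are kept. The unit vector is built with
  \<open>FZero\<close> because the number 0 is a field element but need not be the zero of the
  field.\<close>

definition Column :: com where
  "Column =
     For Vu (Plus (Var Vk) (Var Vk)) (AssignArr Acur (Var Vu) FZero) ;;
     AssignArr Acur (Var Vr) FOne ;;
     Assign Vp (Const 0) ;;
     For Vt (Var Vr) Eliminate ;;
     For Vu (Plus (Var Vk) (Var Vk))
       (AssignArr Abase (Var Ve) (Arr Acur (Var Vu)) ;;
        Assign Ve (Plus (Var Ve) (Const 1))) ;;
     Row Vr ;;
     AssignArr Apiv (Var Vr) (Var Vy) ;;
     Cond (Equal (Var Vy) FZero) (Assign Vok (Const 0)) Skip"

text \<open>Each call recomputes the earlier columns, so that one triangle at a time is stored; this
  costs a polynomial factor.\<close>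

definition Window :: com where
  "Window = Assign Ve (Const 0) ;; For Vr (Plus (Var Vs) (Const 1)) Column"

text \<open>The offsets \<open>d < k - i\<close> enumerate exactly the pairs with
  \<open>i + k \<le> j\<close> and \<open>j < 2 * k\<close>.\<close>

definition Check :: com where
  "Check =
     Assign Vok (Const 1) ;;
     For Vt (Var Vs) (Cond (Equal (Arr Apts (Var Vt)) (Var Vx)) (Assign Vok (Const 0)) Skip) ;;
     For Vi (Var Vk)
       (For Vd (Minus (Var Vk) (Var Vi))
          (Assign Vj (Plus (Plus (Var Vk) (Var Vi)) (Var Vd)) ;; Window))"

text \<open>The loop has no upper limit of its own; it stops because a suitable element below q
  exists.\<close>

definition Search :: com where
  "Search =
     Assign Vx (Const 0) ;;
     Assign Vok (Const 0) ;;
     While (Equal (Var Vok) (Const 0))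
       (AssignArr Apts (Var Vs) (Var Vx) ;;
        Check ;;
        Assign Vx (Plus (Var Vx) (Const 1)))"

definition Greedy :: com where
  "Greedy = For Vs (Plus (Var Vk) (Var Vk)) Search"

lemma mods_Row [simp]: "mods (Row \<tau>) = {Vu, Vy, Vpf, Vpg, Vxf, Vxg}" "amods (Row \<tau>) = {}"
  by (auto simp: Row_def)

lemma mods_Eliminate [simp]:
  "mods Eliminate = {Vu, Vy, Vpf, Vpg, Vxf, Vxg, Vc, Vp}" "amods Eliminate = {Acur}"
  by (auto simp: Eliminate_def)

lemma mods_Column [simp]:
  "mods Column = {Vok, Vt, Vu, Vy, Vpf, Vpg, Vxf, Vxg, Vc, Vp, Ve}"
  "amods Column = {Acur, Abase, Apiv}"
  by (auto simp: Column_def)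

lemma mods_Window [simp]:
  "mods Window = {Vok, Vr, Vt, Vu, Vy, Vpf, Vpg, Vxf, Vxg, Vc, Vp, Ve}"
  "amods Window = {Acur, Abase, Apiv}"
  by (auto simp: Window_def)

lemma mods_Check [simp]:
  "mods Check = {Vok, Vi, Vj, Vr, Vt, Vu, Vy, Vpf, Vpg, Vxf, Vxg, Vc, Vp, Ve, Vd}"
  "amods Check = {Acur, Abase, Apiv}"
  by (auto simp: Check_def)

lemma mods_Search [simp]:
  "mods Search = {Vx, Vok, Vi, Vj, Vr, Vt, Vu, Vy, Vpf, Vpg, Vxf, Vxg, Vc, Vp, Ve, Vd}"
  "amods Search = {Apts, Acur, Abase, Apiv}"
  by (auto simp: Search_def)


section \<open>Correctness of the search\<close>

locale indexed_field = field F for F :: "nat ring" (structure) +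
  fixes q :: nat
  assumes carrier_eq: "carrier F = {..<q}"
begin

text \<open>Field operations default to the number 0 outside the carrier, so they compute what is
  intended only while array entries are field elements.\<close>

definition arrays_ok :: "(nat \<Rightarrow> nat \<Rightarrow> nat) \<Rightarrow> bool" where
  "arrays_ok A \<longleftrightarrow> (\<forall>a x. A a x \<in> carrier F)"

lemma arrays_okD [simp]: "arrays_ok A \<Longrightarrow> A a x \<in> carrier F"
  by (simp add: arrays_ok_def)

lemma arrays_ok_upd [simp]:
  "arrays_ok A \<Longrightarrow> v \<in> carrier F \<Longrightarrow> arrays_ok (A(a := (A a)(x := v)))"
  by (simp add: arrays_ok_def)

definition window :: "nat \<Rightarrow> (nat \<Rightarrow> nat) \<Rightarrow> nat \<Rightarrow> nat \<Rightarrow> store \<Rightarrow> bool" where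
  "window k \<alpha> i j s \<longleftrightarrow>
     fst s Vk = k \<and> fst s Vi = i \<and> fst s Vj = j \<and> snd s Apts = \<alpha> \<and> arrays_ok (snd s)"

text \<open>This is one round of the loop of \<open>Row\<close>: \<open>a\<close> and
  \<open>b\<close> are the partial sums of f and g, \<open>p\<close> and \<open>r\<close> the
  current powers, and \<open>z\<close> the factor zero or one that switches g off in row
  \<open>i\<close>.\<close>

lemma row_step:
  assumes "a \<in> carrier F" "b \<in> carrier F" "v \<in> carrier F" "w \<in> carrier F" "p \<in> carrier F"
    "r \<in> carrier F" "z \<in> carrier F"
  shows "(a \<ominus> z \<otimes> b) \<oplus> (v \<otimes> p \<oplus> \<ominus> (w \<otimes> (z \<otimes> r))) = (v \<otimes> p \<oplus> a) \<ominus> z \<otimes> (w \<otimes> r \<oplus> b)"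
  using assms by algebra

lemma run_Row:
  assumes w: "window k \<alpha> i j s" and \<tau>: "fst s \<tau> = t" "\<tau> \<in> {Vr, Vt}" and L: "k \<le> L"
  shows "run F L (Row \<tau>) s
    (\<lambda>s'. window k \<alpha> i j s' \<and> snd s' = snd s \<and> fst s' Vy = row k \<alpha> i j t (snd s Acur))"
proof -
  define v where "v = snd s Acur"
  define x where "x = \<alpha> t"
  define y where "y = \<alpha> (if i < t \<and> t \<le> j then t - 1 else t)"
  define z where "z = (if t = i then \<zero> else \<one>)"
  define I where "I n s' \<longleftrightarrow> snd s' = snd s \<and> fst s' Vk = k \<and> fst s' Vxf = x \<and> fst s' Vxg = y \<and>
    fst s' Vpf = x [^] n \<and> fst s' Vpg = z \<otimes> y [^] n \<and>
    fst s' Vy = ev v n x \<ominus> z \<otimes> ev (\<lambda>u. v (k + u)) n y" for n and s' :: store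
  have ok: "arrays_ok (snd s)" "snd s Apts = \<alpha>" "fst s Vk = k" "fst s Vi = i" "fst s Vj = j"
    using w by (simp_all add: window_def)
  have v: "v u \<in> carrier F" for u using ok by (simp add: v_def)
  have \<alpha>: "\<alpha> u \<in> carrier F" for u using ok(1) unfolding ok(2)[symmetric] by simp
  have c: "x \<in> carrier F" "y \<in> carrier F" "z \<in> carrier F" using \<alpha> by (simp_all add: x_def y_def z_def)
  have row: "row k \<alpha> i j t v = ev v k x \<ominus> z \<otimes> ev (\<lambda>u. v (k + u)) k y"
  proof -
    have "ev (\<lambda>u. v (k + u)) k y \<in> carrier F" using c v by simp
    then have "z \<otimes> ev (\<lambda>u. v (k + u)) k y = (if t = i then \<zero> else ev (\<lambda>u. v (k + u)) k y)"
      unfolding z_def by (cases "t = i") simp_all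
    then show ?thesis by (simp only: row_def x_def y_def)
  qed
  show ?thesis
    unfolding Row_def
  proof (intro run_Seq_Assign run_Seq_Cond_Assign, rule run_conseq[OF run_For[where N = k and I = I]],
      goal_cases)
    case 1
    show ?case by (rule L)
  next
    case 2
    show ?case by simp
  next
    case (3 s')
    then show ?case using ok by (simp add: frame_def)
  next
    case 4
    have "\<tau> \<noteq> Vpf" "\<tau> \<noteq> Vxf" "\<tau> \<noteq> Vpg" "\<tau> \<noteq> Vxg" using \<tau>(2) by auto
    then show ?case using ok \<tau>(1) c by (simp add: I_def x_def y_def z_def a_minus_def)
  next
    case (5 m s' w)
    then show ?case by (simp add: I_def)
  next
    case (6 m s')
    then have "snd s' = snd s" "fst s' Vk = k" "fst s' Vxf = x" "fst s' Vxg = y"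
      "fst s' Vpf = x [^] m" "fst s' Vpg = z \<otimes> y [^] m" "fst s' Vu = m"
      "fst s' Vy = ev v m x \<ominus> z \<otimes> ev (\<lambda>u. v (k + u)) m y" by (simp_all add: I_def)
    then show ?case
      using c v \<alpha> by (intro run_Seq_Assign run_Assign)
        (simp add: I_def v_def[symmetric] row_step m_assoc)
  next
    case (7 s')
    then show ?case using ok row by (simp add: I_def v_def window_def frame_def arrays_ok_def)
  qed
qed

definition triangle :: "nat \<Rightarrow> (nat \<Rightarrow> nat) \<Rightarrow> nat \<Rightarrow> nat \<Rightarrow> nat \<Rightarrow> store \<Rightarrow> bool" where
  "triangle k \<alpha> i j r s \<longleftrightarrow> (\<forall>t<r. snd s Apiv t = pivot k \<alpha> i j t \<and> pivot k \<alpha> i j t \<noteq> \<zero> \<and>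
     (\<forall>u<2 * k. snd s Abase (t * (2 * k) + u) = col k \<alpha> i j t t u))"

lemma run_Eliminate:
  assumes w: "window k \<alpha> i j s" and tri: "triangle k \<alpha> i j r s" and t: "t < r"
    and s: "fst s Vt = t" "fst s Vp = t * (2 * k)"
    and cur: "\<And>u. u < 2 * k \<Longrightarrow> snd s Acur u = col k \<alpha> i j t r u" and L: "2 * k \<le> L"
  shows "run F L Eliminate s (\<lambda>s'. window k \<alpha> i j s' \<and> triangle k \<alpha> i j r s' \<and>
    fst s' Vp = Suc t * (2 * k) \<and> (\<forall>u<2 * k. snd s' Acur u = col k \<alpha> i j (Suc t) r u))"
proof -
  define p where "p = pivot k \<alpha> i j t"
  define c where "c = \<ominus> (row k \<alpha> i j t (col k \<alpha> i j t r) \<otimes> inv p)"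
  have ok: "arrays_ok (snd s)" "snd s Apts = \<alpha>" "fst s Vk = k" "fst s Vi = i" "fst s Vj = j"
    using w by (simp_all add: window_def)
  have \<alpha>: "\<alpha> u \<in> carrier F" for u using ok(1) unfolding ok(2)[symmetric] by simp
  have p: "p \<in> carrier F" "p \<noteq> \<zero>" "snd s Apiv t = p" using \<alpha> tri t by (auto simp: p_def triangle_def)
  have inv: "inv p \<in> carrier F" using p by (simp add: field_Units)
  then have c: "c \<in> carrier F" using \<alpha> by (simp add: c_def)
  have row: "row k \<alpha> i j t (snd s Acur) = row k \<alpha> i j t (col k \<alpha> i j t r)"
    using cur by (rule row_cong)
  have col_Suc: "col k \<alpha> i j (Suc t) r u = col k \<alpha> i j t r u \<oplus> c \<otimes> col k \<alpha> i j t t u" for u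
    using p by (simp add: c_def p_def pivot_def)
  \<comment> \<open>\<open>Acur\<close> is overwritten in place, which is harmless because the
    factor c was computed from the old column before the loop.\<close>
  define I where "I n s' \<longleftrightarrow> arrays_ok (snd s') \<and> fst s' Vc = c \<and> fst s' Vp = t * (2 * k) + n \<and>
    (\<forall>u<2 * k. snd s' Acur u = (if u < n then col k \<alpha> i j (Suc t) r u else col k \<alpha> i j t r u))"
    for n and s' :: store
  show ?thesis
    unfolding Eliminate_def
  proof (rule run_Seq[OF run_Row[OF w s(1)]], goal_cases)
    case 1
    show ?case by simp
  next
    case 2
    show ?case using L by simp
  next
    case (3 s1)
    then have s1: "fst s1 Vy = row k \<alpha> i j t (col k \<alpha> i j t r)" "snd s1 = snd s"
      "fst s1 Vk = k" "fst s1 Vi = i" "fst s1 Vj = j" "fst s1 Vt = t" "fst s1 Vp = t * (2 * k)"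
      using row s by (simp_all add: window_def frame_def)
    then have vc: "aval F s1 (FNeg (FMul (Var Vy) (FInv (Arr Apiv (Var Vt))))) = c"
      using p inv \<alpha> by (simp add: c_def)
    show ?case
    proof (rule run_Seq_Assign, unfold vc, rule run_conseq[OF run_For[where N = "2 * k" and I = I]],
        goal_cases)
      case 1
      show ?case by (rule L)
    next
      case 2
      show ?case by simp
    next
      case (3 s')
      then show ?case using s1 by (simp add: frame_def)
    next
      case 4
      show ?case using s1 ok cur by (simp add: I_def arrays_ok_def)
    next
      case (5 m s' w)
      then show ?case by (simp add: I_def)
    next
      case (6 m s')
      then have "snd s' Abase = snd s Abase" using s1 by (simp add: frame_def)
      then have "snd s' Abase (t * (2 * k) + m) = col k \<alpha> i j t t m"
        using tri t 6(1) by (simp add: triangle_def)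
      moreover have "arrays_ok (snd s')" "fst s' Vc = c" "fst s' Vp = t * (2 * k) + m" "fst s' Vu = m"
        "\<forall>u<2 * k. snd s' Acur u = (if u < m then col k \<alpha> i j (Suc t) r u else col k \<alpha> i j t r u)"
        using 6 by (simp_all add: I_def)
      ultimately show ?case
        using 6(1) c \<alpha> by (intro run_Seq_AssignArr run_Assign)
          (simp add: I_def col_Suc less_Suc_eq del: col.simps)
    next
      case (7 s')
      then have "snd s' Abase = snd s Abase" "snd s' Apiv = snd s Apiv" "snd s' Apts = \<alpha>"
        "fst s' Vk = k" "fst s' Vi = i" "fst s' Vj = j"
        using s1 ok by (simp_all add: frame_def)
      then show ?case using 7(1) tri by (simp add: I_def window_def triangle_def)
    qed
  qed
qed


lemma run_Column:
  assumes w: "window k \<alpha> i j s" and tri: "triangle k \<alpha> i j r s" and r: "fst s Vr = r" "r < 2 * k"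
    and e: "fst s Ve = r * (2 * k)" and L: "2 * k \<le> L"
  shows "run F L Column s (\<lambda>s'. window k \<alpha> i j s' \<and>
    (pivot k \<alpha> i j r \<noteq> \<zero> \<longrightarrow> triangle k \<alpha> i j (Suc r) s') \<and> fst s' Ve = Suc r * (2 * k) \<and>
    fst s' Vok = (if pivot k \<alpha> i j r = \<zero> then 0 else fst s Vok))"
proof -
  have ok: "arrays_ok (snd s)" "snd s Apts = \<alpha>" "fst s Vk = k" "fst s Vi = i" "fst s Vj = j"
    using w by (simp_all add: window_def)
  have \<alpha>: "\<alpha> u \<in> carrier F" for u using ok(1) unfolding ok(2)[symmetric] by simp
  define P where "P = (\<lambda>s' :: store. fst s' Vk = k \<and> fst s' Vi = i \<and> fst s' Vj = j \<and>
    fst s' Vr = r \<and> fst s' Ve = r * (2 * k) \<and> fst s' Vok = fst s Vok \<and> snd s' Apts = \<alpha> \<and>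
    snd s' Abase = snd s Abase \<and> snd s' Apiv = snd s Apiv)"
  have P: "P s" using ok r e by (simp add: P_def)
  show ?thesis
    unfolding Column_def
  proof (rule run_Seq[OF run_For[where N = "2 * k" and
        I = "\<lambda>n s'. arrays_ok (snd s') \<and> (\<forall>u<n. snd s' Acur u = \<zero>)"]], goal_cases)
    case (6 m s')
    then show ?case by (intro run_AssignArr) (simp add: less_Suc_eq)
  next
    case (7 s1)
    then have "P s1" using P by (simp add: P_def frame_def)
    define s2 where "s2 = ((fst s1)(Vp := 0), (snd s1)(Acur := (snd s1 Acur)(r := \<one>)))"
    have s2: "P s2" "arrays_ok (snd s2)" "fst s2 Vp = 0"
      "\<And>u. u < 2 * k \<Longrightarrow> snd s2 Acur u = col k \<alpha> i j 0 r u"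
      using \<open>P s1\<close> 7(1) by (simp_all add: P_def s2_def)
    have step2: "run F L c s2 Q \<Longrightarrow>
      run F L (AssignArr Acur (Var Vr) FOne ;; Assign Vp (Const 0) ;; c) s1 Q" for c Q
      using \<open>P s1\<close> by (intro run_Seq_AssignArr run_Seq_Assign) (simp add: s2_def P_def)
    show ?case
    proof (rule step2, rule run_Seq[OF run_For[where N = r and
        I = "\<lambda>t s'. window k \<alpha> i j s' \<and> triangle k \<alpha> i j r s' \<and> fst s' Vp = t * (2 * k) \<and>
          (\<forall>u<2 * k. snd s' Acur u = col k \<alpha> i j t r u)"]], goal_cases)
      case 1
      show ?case using r L by simp
    next
      case 2
      show ?case by simp
    next
      case (3 s')
      then show ?case using s2 by (simp add: frame_def P_def)
    next
      case 4
      show ?case using s2 tri by (simp add: window_def triangle_def P_def)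
    next
      case (5 m s' v)
      then show ?case by (simp add: window_def triangle_def)
    next
      case (6 m s')
      then show ?case using L by (intro run_Eliminate) simp_all
    next
      case (7 s3)
      have s3: "P s3" using s2(1) 7(2) by (simp add: P_def frame_def)
      have b3: "snd s3 Acur u = col k \<alpha> i j r r u" if "u < 2 * k" for u using 7(1) that by simp
      have tri3: "triangle k \<alpha> i j r s3" using 7 by simp
      show ?case
      proof (rule run_Seq[OF run_For[where N = "2 * k" and
          I = "\<lambda>n s'. arrays_ok (snd s') \<and> fst s' Ve = r * (2 * k) + n \<and> triangle k \<alpha> i j r s' \<and>
            (\<forall>u<n. snd s' Abase (r * (2 * k) + u) = col k \<alpha> i j r r u)"]], goal_cases)
        case 1
        show ?case by (rule L)
      next
        case 2
        show ?case by simp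
      next
        case (3 s')
        then show ?case using s3 by (simp add: frame_def P_def)
      next
        case 4
        show ?case using 7 s3 by (simp add: window_def P_def)
      next
        case (5 m s' v)
        then show ?case by (simp add: triangle_def)
      next
        case (6 m s')
        have "snd s' Acur m = col k \<alpha> i j r r m" using 6 b3 by (simp add: frame_def)
        \<comment> \<open>Blocks of length \<open>2 * k\<close> do not overlap, so writing column r
          spares the finished columns.\<close>
        moreover have "t * (2 * k) + u \<noteq> r * (2 * k) + m" if "t < r" "u < 2 * k" for t u
        proof -
          have "t * (2 * k) + u < Suc t * (2 * k)" using that by simp
          also have "\<dots> \<le> r * (2 * k)" using that by (intro mult_le_mono1) simp
          finally show ?thesis by simp
        qed
        ultimately show ?case
          using 6 \<alpha> by (intro run_Seq_AssignArr run_Assign) (auto simp: triangle_def less_Suc_eq)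
      next
        case (7 s4)
        have w4: "window k \<alpha> i j s4" "fst s4 Vr = r" "fst s4 Vok = fst s Vok" "snd s4 Acur = snd s3 Acur"
          "fst s4 Ve = Suc r * (2 * k)"
          using s3 7 by (simp_all add: window_def P_def frame_def)
        have piv: "row k \<alpha> i j r (snd s4 Acur) = pivot k \<alpha> i j r"
          unfolding pivot_def w4(4) using b3 by (rule row_cong)
        show ?case
        proof (rule run_Seq[OF run_Row[OF w4(1,2)]], goal_cases)
          case 1
          show ?case by simp
        next
          case 2
          show ?case using L by simp
        next
          case (3 s5)
          define s6 where "s6 = (fst s5, (snd s5)(Apiv := (snd s5 Apiv)(r := pivot k \<alpha> i j r)))"
          have s5: "fst s5 Vr = r" "fst s5 Vy = pivot k \<alpha> i j r" "fst s5 Vok = fst s Vok"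
            "fst s5 Ve = Suc r * (2 * k)" "window k \<alpha> i j s5" "snd s5 = snd s4"
            using 3 w4 piv by (simp_all add: frame_def)
          have "window k \<alpha> i j s6" using s5(5) \<alpha> by (simp add: s6_def window_def)
          moreover have "triangle k \<alpha> i j (Suc r) s6" if "pivot k \<alpha> i j r \<noteq> \<zero>"
            using 7(1) that by (simp add: triangle_def s6_def s5(6) less_Suc_eq)
          ultimately have "run F L (Cond (Equal (Var Vy) FZero) (Assign Vok (Const 0)) Skip) s6
             (\<lambda>s'. window k \<alpha> i j s' \<and>
              (pivot k \<alpha> i j r \<noteq> \<zero> \<longrightarrow> triangle k \<alpha> i j (Suc r) s') \<and> fst s' Ve = Suc r * (2 * k) \<and>
              fst s' Vok = (if pivot k \<alpha> i j r = \<zero> then 0 else fst s Vok))"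
            using s5 by (intro run_Cond run_Assign run_Skip)
              (simp_all add: s6_def window_def triangle_def)
          then show ?case using s5 by (intro run_Seq_AssignArr) (simp add: s6_def)
        qed
      qed
    qed
  qed (use ok L r in \<open>simp_all add: frame_def\<close>)
qed

text \<open>Only pivot n may vanish, so the triangle is claimed up to \<open>m = n\<close> and
  \<open>Vok\<close> can change only in the last round.\<close>

lemma run_Window:
  assumes w: "window k \<alpha> i j s" and n: "fst s Vs = n" "n < 2 * k"
    and piv: "\<And>r. r < n \<Longrightarrow> pivot k \<alpha> i j r \<noteq> \<zero>" and L: "2 * k \<le> L"
  shows "run F L Window s (\<lambda>s'. window k \<alpha> i j s' \<and>
    fst s' Vok = (if pivot k \<alpha> i j n = \<zero> then 0 else fst s Vok))"
  unfolding Window_def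
proof (rule run_Seq_Assign, rule run_conseq[OF run_For[where N = "Suc n" and
    I = "\<lambda>m s'. window k \<alpha> i j s' \<and> (m \<le> n \<longrightarrow> triangle k \<alpha> i j m s') \<and> fst s' Ve = m * (2 * k) \<and>
      fst s' Vok = (if m = Suc n \<and> pivot k \<alpha> i j n = \<zero> then 0 else fst s Vok)"]], goal_cases)
  case 1
  show ?case using n L by simp
next
  case 2
  show ?case by simp
next
  case (3 s')
  then show ?case using n by (simp add: frame_def)
next
  case 4
  show ?case using w by (simp add: window_def triangle_def)
next
  case (5 m s' v)
  then show ?case by (simp add: window_def triangle_def)
next
  case (6 m s')
  have "run F L Column s' (\<lambda>s''. window k \<alpha> i j s'' \<and>
    (pivot k \<alpha> i j m \<noteq> \<zero> \<longrightarrow> triangle k \<alpha> i j (Suc m) s'') \<and> fst s'' Ve = Suc m * (2 * k) \<and>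
    fst s'' Vok = (if pivot k \<alpha> i j m = \<zero> then 0 else fst s' Vok))"
    using 6 n L by (intro run_Column) simp_all
  moreover have "m < n \<or> m = n" using 6(1) by auto
  ultimately show ?case
    by (elim run_conseq disjE) (use 6(2) piv in auto)
next
  case (7 s')
  then show ?case by auto
qed

text \<open>The older conditions do not read the new point; a candidate therefore needs only a
  comparison with the old points and one new pivot per pair.\<close>

lemma good_Suc_iff:
  assumes "good k \<alpha> n"
  shows "good k \<alpha> (Suc n) \<longleftrightarrow> (\<forall>t<n. \<alpha> t \<noteq> \<alpha> n) \<and> (\<forall>i<k. \<forall>d<k - i. pivot k \<alpha> i (k + i + d) n \<noteq> \<zero>)"
proof -
  have "inj_on \<alpha> {..<Suc n} \<longleftrightarrow> (\<forall>t<n. \<alpha> t \<noteq> \<alpha> n)"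
    using assms by (auto simp: good_def lessThan_Suc) (metis image_eqI lessThan_iff)
  moreover have "(\<forall>i j. i + k \<le> j \<and> j < 2 * k \<longrightarrow> (\<forall>r<Suc n. pivot k \<alpha> i j r \<noteq> \<zero>)) \<longleftrightarrow>
    (\<forall>i<k. \<forall>d<k - i. pivot k \<alpha> i (k + i + d) n \<noteq> \<zero>)" (is "?A \<longleftrightarrow> ?B")
  proof
    assume ?A
    then show ?B by auto
  next
    assume B: ?B
    show ?A
    proof (intro allI impI)
      fix i j r assume ij: "i + k \<le> j \<and> j < 2 * k" and r: "r < Suc n"
      then have "j = k + i + (j - (k + i))" "i < k" "j - (k + i) < k - i" by auto
      then have "pivot k \<alpha> i j n \<noteq> \<zero>" using B by metis
      then show "pivot k \<alpha> i j r \<noteq> \<zero>" using assms ij r by (auto simp: good_def less_Suc_eq)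
    qed
  qed
  ultimately show ?thesis by (simp add: good_def)
qed

section \<open>Candidate test and greedy search\<close>

lemma run_Check:
  assumes s: "arrays_ok (snd s)" "fst s Vk = k" "fst s Vs = n" "fst s Vx = x" "snd s Apts = \<alpha>"
    and n: "n < 2 * k" and good: "good k \<alpha> n" and x: "\<alpha> n = x" and L: "2 * k \<le> L"
  shows "run F L Check s (\<lambda>s'. arrays_ok (snd s') \<and> fst s' Vok = (if good k \<alpha> (Suc n) then 1 else 0))"
proof -
  define D where "D \<longleftrightarrow> (\<forall>t<n. \<alpha> t \<noteq> x)"
  define E where "E i m \<longleftrightarrow> (\<forall>d<m. pivot k \<alpha> i (k + i + d) n \<noteq> \<zero>)" for i m
  have G: "good k \<alpha> (Suc n) \<longleftrightarrow> D \<and> (\<forall>i<k. E i (k - i))"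
    using good_Suc_iff[OF good] x by (simp add: D_def E_def)
  show ?thesis
    unfolding Check_def
  proof (rule run_Seq_Assign, rule run_Seq[OF run_For[where N = n and
      I = "\<lambda>m s'. arrays_ok (snd s') \<and> fst s' Vok = (if \<forall>t<m. \<alpha> t \<noteq> x then 1 else 0)"]], goal_cases)
    case (6 m s')
    then show ?case
      using s by (intro run_Cond run_Assign run_Skip) (auto simp: frame_def less_Suc_eq)
  next
    case (7 s1)
    then have s1: "arrays_ok (snd s1)" "fst s1 Vok = (if D then 1 else 0)" "fst s1 Vk = k" "fst s1 Vs = n"
      "snd s1 Apts = \<alpha>"
      using s by (simp_all add: frame_def D_def)
    show ?case
    proof (rule run_conseq[OF run_For[where N = k and
        I = "\<lambda>m s'. arrays_ok (snd s') \<and> fst s' Vok = (if D \<and> (\<forall>i<m. E i (k - i)) then 1 else 0)"]], goal_cases)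
      case (6 i s2)
      then have s2: "arrays_ok (snd s2)" "fst s2 Vok = (if D \<and> (\<forall>i'<i. E i' (k - i')) then 1 else 0)"
        "fst s2 Vk = k" "fst s2 Vs = n" "snd s2 Apts = \<alpha>" "fst s2 Vi = i"
        using s1 by (simp_all add: frame_def)
      show ?case
      proof (rule run_conseq[OF run_For[where N = "k - i" and
          I = "\<lambda>m s'. arrays_ok (snd s') \<and> fst s' Vok = (if D \<and> (\<forall>i'<i. E i' (k - i')) \<and> E i m then 1 else 0)"]],
          goal_cases)
        case (6 d s3)
        define s4 where "s4 = ((fst s3)(Vj := k + i + d), snd s3)"
        have s4: "fst s4 Vs = n" "window k \<alpha> i (k + i + d) s4"
          "fst s4 Vok = (if D \<and> (\<forall>i'<i. E i' (k - i')) \<and> E i d then 1 else 0)"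
          using 6 s2 by (simp_all add: s4_def frame_def window_def)
        have "run F L Window s4 (\<lambda>s'. window k \<alpha> i (k + i + d) s' \<and>
            fst s' Vok = (if pivot k \<alpha> i (k + i + d) n = \<zero> then 0 else fst s4 Vok))"
          using s4 n good L 6(1) \<open>i < k\<close> by (intro run_Window) (auto simp: good_def)
        then have "run F L Window s4 (\<lambda>s'. arrays_ok (snd s') \<and>
            fst s' Vok = (if D \<and> (\<forall>i'<i. E i' (k - i')) \<and> E i (Suc d) then 1 else 0))"
          by (rule run_conseq) (use s4 in \<open>auto simp: window_def E_def less_Suc_eq\<close>)
        then show ?case using 6 s2 by (intro run_Seq_Assign) (simp add: s4_def frame_def)
      next
        case (7 s')
        then show ?case by (auto simp: less_Suc_eq)
      qed (use s2 L \<open>i < k\<close> in \<open>auto simp: frame_def E_def\<close>)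
    next
      case (7 s')
      then show ?case by (simp add: G)
    qed (use s1 L in \<open>auto simp: frame_def\<close>)
  qed (use s n L in \<open>auto simp: frame_def\<close>)
qed

lemma run_Search:
  assumes s: "arrays_ok (snd s)" "fst s Vk = k" "fst s Vs = n" and n: "n < 2 * k"
    and good: "good k (snd s Apts) n" and k: "2 * k + k * (2 * k) * k < q"
  shows "run F q Search s (\<lambda>s'. arrays_ok (snd s') \<and> good k (snd s' Apts) (Suc n))"
proof -
  define \<alpha> where "\<alpha> = snd s Apts"
  \<comment> \<open>Candidates are tried in increasing order, so the search ends with the least good
    one, after \<open>Suc N\<close> rounds.\<close>
  define N where "N = (LEAST x. good k (\<alpha>(n := x)) (Suc n))"
  have \<alpha>: "\<alpha> u \<in> carrier F" for u using s by (simp add: \<alpha>_def)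
  have "\<exists>x\<in>carrier F. good k (\<alpha>(n := x)) (Suc n)"
    using \<alpha> good n k by (intro good_extend) (simp_all add: \<alpha>_def carrier_eq)
  then obtain x where x: "x < q" "good k (\<alpha>(n := x)) (Suc n)" by (auto simp: carrier_eq)
  have N: "good k (\<alpha>(n := N)) (Suc n)" unfolding N_def using x(2) by (rule LeastI)
  have "N \<le> x" unfolding N_def using x(2) by (rule Least_le)
  then have "N < q" using x by simp
  have below: "\<not> good k (\<alpha>(n := m)) (Suc n)" if "m < N" for m
    using that not_less_Least unfolding N_def by blast
  \<comment> \<open>\<open>Vx\<close> is advanced before the guard is tested, so the last round
    leaves \<open>m = Suc N\<close> with \<open>N\<close> stored. Before the first round the entry
    is still the old one, hence the unspecified y.\<close>
  define I where "I m s' \<longleftrightarrow> arrays_ok (snd s') \<and> fst s' Vk = k \<and> fst s' Vs = n \<and> fst s' Vx = m \<and>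
    (\<exists>y. snd s' Apts = \<alpha>(n := y) \<and> (m = Suc N \<longrightarrow> y = N)) \<and> fst s' Vok = (if m = Suc N then 1 else 0)"
    for m and s' :: store
  show ?thesis
    unfolding Search_def
  proof (intro run_Seq_Assign, rule run_conseq[OF run_While[where N = "Suc N" and I = I]], goal_cases)
    case 1
    show ?case using \<open>N < q\<close> by simp
  next
    case 2
    have "\<alpha> = \<alpha>(n := \<alpha> n)" by simp
    then show ?case using s(1-3) unfolding I_def by (intro conjI exI[of _ "\<alpha> n"]) (simp_all add: \<alpha>_def)
  next
    case (3 m s')
    then obtain y where I: "arrays_ok (snd s')" "fst s' Vk = k" "fst s' Vs = n" "fst s' Vx = m"
      "snd s' Apts = \<alpha>(n := y)" "fst s' Vok = 0" unfolding I_def by auto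
    define s1 where "s1 = (fst s', (snd s')(Apts := \<alpha>(n := m)))"
    have "m \<in> carrier F" using 3(1) \<open>N < q\<close> by (simp add: carrier_eq)
    then have s1: "arrays_ok (snd s1)" "fst s1 Vk = k" "fst s1 Vs = n" "fst s1 Vx = m" "snd s1 Apts = \<alpha>(n := m)"
      using I \<alpha> by (simp_all add: s1_def arrays_ok_def)
    \<comment> \<open>Neither the pivots nor the injectivity below n read point n, so any candidate
      may overwrite it.\<close>
    have "pivot k (\<alpha>(n := m)) i j r = pivot k \<alpha> i j r" if "r < n" for i j r
      using that by (intro pivot_cong_points) simp
    moreover have "inj_on (\<alpha>(n := m)) {..<n} \<longleftrightarrow> inj_on \<alpha> {..<n}" by (intro inj_on_cong) simp
    ultimately have g: "good k (\<alpha>(n := m)) n" using good by (simp add: good_def \<alpha>_def)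
    have "2 * k \<le> q" using k by simp
    then have "run F q Check s1
      (\<lambda>s''. arrays_ok (snd s'') \<and> fst s'' Vok = (if good k (\<alpha>(n := m)) (Suc n) then 1 else 0))"
      using s1 n g by (intro run_Check) simp_all
    then have "run F q (Check ;; Assign Vx (Plus (Var Vx) (Const 1))) s1 (I (Suc m))"
    proof (rule run_Seq)
      fix s2 assume s2: "arrays_ok (snd s2) \<and> fst s2 Vok = (if good k (\<alpha>(n := m)) (Suc n) then 1 else 0)"
        and fr: "frame Check s1 s2"
      have fr2: "fst s2 Vk = k" "fst s2 Vs = n" "fst s2 Vx = m" "snd s2 Apts = \<alpha>(n := m)"
        using fr s1 by (simp_all add: frame_def)
      have "good k (\<alpha>(n := m)) (Suc n) \<longleftrightarrow> m = N"
        using 3(1) N below by (metis less_antisym)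
      then show "run F q (Assign Vx (Plus (Var Vx) (Const 1))) s2 (I (Suc m))"
        using s2 fr2 by (intro run_Assign) (simp add: I_def exI[of _ m])
    qed
    then have "run F q (AssignArr Apts (Var Vs) (Var Vx) ;; Check ;; Assign Vx (Plus (Var Vx) (Const 1)))
        s' (I (Suc m))"
      using I by (intro run_Seq_AssignArr) (simp add: s1_def)
    then show ?case using I by simp
  next
    case (4 s')
    then show ?case by (simp add: I_def)
  next
    case (5 s')
    then show ?case using N by (auto simp: I_def)
  qed
qed

lemma run_Greedy:
  assumes "2 * k + k * (2 * k) * k < q"
  shows "run F q Greedy (input_store k q) (\<lambda>s'. arrays_ok (snd s') \<and> good k (snd s' Apts) (2 * k))"
  unfolding Greedy_def
proof (rule run_For[where N = "2 * k" and
    I = "\<lambda>m s'. arrays_ok (snd s') \<and> good k (snd s' Apts) m"], goal_cases)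
  case 1
  show ?case using assms by simp
next
  case 2
  show ?case by simp
next
  case (3 s')
  then show ?case by (simp add: frame_def input_store_def)
next
  case 4
  have "0 < q" using assms by simp
  then show ?case by (simp add: input_store_def arrays_ok_def good_def carrier_eq)
next
  case (5 m s' v)
  then show ?case by simp
next
  case (6 m s')
  then show ?case using assms by (intro run_Search) (simp_all add: frame_def input_store_def)
qed

end

text \<open>Each summand is at most \<open>2 * k ^ 4\<close>, so the sum is at most
  \<open>4 * k ^ 4\<close>.\<close>

lemma field_size_bound:
  fixes k q :: nat
  assumes "1 \<le> k" "100 * k ^ 4 \<le> q"
  shows "2 * k + k * (2 * k) * k < q"
proof -
  have "k \<le> k ^ 4" "k ^ 3 \<le> k ^ 4" "1 \<le> k ^ 4"
    using assms power_increasing[of 1 4 k] power_increasing[of 3 4 k] by simp_all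
  moreover have "k * (2 * k) * k = 2 * k ^ 3" by (simp add: power3_eq_cube)
  ultimately show ?thesis using assms by linarith
qed

theorem theorem3:
  shows "\<exists>prog :: com. \<forall>C :: nat. \<exists>(a :: nat) (d :: nat).
    \<forall>(k :: nat) (q :: nat) (F :: nat ring).
      k \<ge> 1 \<and> primepow q \<and> 100 * k ^ 4 \<le> q \<and> q \<le> C * k ^ 4 \<and>
      field F \<and> carrier F = {..<q} \<longrightarrow>
      (\<exists>t s \<alpha>. exec F prog (input_store k q) t s \<and> t \<le> a * k ^ d \<and>
        \<alpha> = output_vector (2 * k) s \<and> set \<alpha> \<subseteq> carrier F \<and> distinct \<alpha> \<and>
        corrects_single_insdel (carrier F) (rs_code F k \<alpha>))"
proof -
  \<comment> \<open>The bound \<open>L\<close> will be q: the search tries elements below q, and all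
    other loops make at most \<open>2 * k\<close> rounds, which is less than q. The numbers b and e
    depend on the program alone.\<close>
  obtain b e where be: "\<forall>L\<ge>1. cost_bound L Greedy \<le> b * L ^ e"
    using cost_bound_polynomial by blast
  show ?thesis
  proof (rule exI[of _ Greedy], rule allI, rule exI, rule exI, intro allI impI, elim conjE)
    fix C k q :: nat and F :: "nat ring"
    assume k: "1 \<le> k" "100 * k ^ 4 \<le> q" "q \<le> C * k ^ 4" and F: "field F" "carrier F = {..<q}"
    interpret indexed_field F q
      using F by (simp add: indexed_field_def indexed_field_axioms_def)
    have q: "2 * k + k * (2 * k) * k < q" using k(1,2) by (rule field_size_bound)
    obtain t s where t: "exec F Greedy (input_store k q) t s" "t \<le> cost_bound q Greedy"
      and s: "arrays_ok (snd s)" "good k (snd s 0) (2 * k)"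
      using run_Greedy[OF q] by (auto elim: runE)
    define \<alpha> where "\<alpha> = output_vector (2 * k) s"
    have \<alpha>: "\<alpha> = map (snd s 0) [0..<2 * k]" by (simp add: \<alpha>_def output_vector_def)
    have "1 \<le> q" using q by simp
    with t(2) be have "t \<le> b * q ^ e" using le_trans by blast
    \<comment> \<open>The upper bound on q turns the estimate in q into one in k; C enters the
      factor, not the exponent.\<close>
    also have "\<dots> \<le> b * (C * k ^ 4) ^ e" using k(3) by (intro mult_le_mono2 power_mono) simp_all
    also have "\<dots> = (b * C ^ e) * k ^ (4 * e)" by (simp add: power_mult_distrib power_mult)
    finally have "t \<le> (b * C ^ e) * k ^ (4 * e)" .
    moreover have "set \<alpha> \<subseteq> carrier F" using s(1) by (auto simp: \<alpha>)
    moreover have "distinct \<alpha>" using s(2) by (simp add: \<alpha> distinct_map good_def atLeast0LessThan)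
    moreover have "corrects_single_insdel (carrier F) (rs_code F k \<alpha>)"
      unfolding \<alpha> using s by (intro good_corrects) simp_all
    ultimately show "\<exists>t s \<alpha>. exec F Greedy (input_store k q) t s \<and> t \<le> (b * C ^ e) * k ^ (4 * e) \<and>
        \<alpha> = output_vector (2 * k) s \<and> set \<alpha> \<subseteq> carrier F \<and> distinct \<alpha> \<and>
        corrects_single_insdel (carrier F) (rs_code F k \<alpha>)"
      using t(1) \<alpha>_def by blast
  qed
qed

end
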